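(* Let $\Gamma$ be a method specification, $\mathcal{L}_1$ a library, $\mathcal{C}$ a client, $I_1,I\subseteq\Sigma$, and $\mathcal{H}_2$ an interface set. Suppose $\mathcal{L}_1:\Gamma$ and $\Gamma\vdash\mathcal{C}$ are safe for $I_1$ and $I$ respectively, and $(\mathcal{L}_1:\Gamma,I_1)\sqsubseteq\mathcal{H}_2$. Then $\mathcal{C}(\mathcal{L}_1)$ is safe for $I*I_1$, and for every $(\sigma,\tau_1)\in[\![\mathcal{C}(\mathcal{L}_1),I*I_1]\!]$ there exist $\sigma'$, $\kappa$ and $l$ such that $(\sigma',\kappa)\in[\![\Gamma\vdash\mathcal{C},I]\!]$, $(l,\mathsf{history}(\kappa))\in\mathcal{H}_2$, $\delta(\sigma')\circ l$ is defined, and $\mathsf{client}(\tau_1)\sim\mathsf{ground}(\kappa)$.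
   Context: Separation algebra. $\Sigma$ is a set with a partial binary operation $*$ that is commutative and associative (both sides defined and equal, or both undefined) and cancellative (each partial map $\sigma*\cdot$ is injective), with a unit $e$. Write $(\sigma_1*\sigma_2)\downarrow$ when defined; $p*q=\{\sigma_1*\sigma_2\mid\sigma_1\in p,\sigma_2\in q,(\sigma_1*\sigma_2)\downarrow\}$. $\sigma_2\setminus\sigma_1$ is the unique $\sigma$ with $\sigma_2=\sigma*\sigma_1$ (undefined if none). Footprint: $\delta(\sigma)=\{\sigma'\mid\forall\sigma''.\,(\sigma'*\sigma'')\downarrow\iff(\sigma*\sigma'')\downarrow\}$; $\delta(\sigma_1)\circ\delta(\sigma_2)=\delta(\sigma_1*\sigma_2)$ if defined, undefined otherwise. Standing assumption: $*$ is cancellative on footprints (whenever $\sigma_1*\sigma_2$, $\sigma_1'*\sigma_2'$ are defined, $\delta(\sigma_1*\sigma_2)=\delta(\sigma_1'*\sigma_2')$ and $\delta(\sigma_1)=\delta(\sigma_1')$ imply $\delta(\sigma_2)=\delta(\sigma_2')$). $l_2\mathbin{\backslash\!\backslash}l_1=\delta(\sigma)$ if $l_1=\delta(\sigma_1),l_2=\delta(\sigma_2),\sigma_2=\sigma_1*\sigma$, undefined otherwise; $l_1\preceq l_2$ iff $l_2\mathbin{\backslash\!\backslash}l_1$ is defined. Histories. Interface actions are $(t,\mathsf{call}\ m(\sigma))$, $(t,\mathsf{ret}\ m(\sigma))$ for threads $t$, methods $m$, states $\sigma$. A history is a finite sequence of interface actions whose projection to each thread alternates calls and returns of matching methods, starting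 with a call. $[\![\varepsilon]\!]^\sharp l=l$; $[\![H\psi]\!]^\sharp l=([\![H]\!]^\sharp l)\circ\delta(\sigma)$ for a call $\psi$ carrying $\sigma$, $([\![H]\!]^\sharp l)\mathbin{\backslash\!\backslash}\delta(\sigma)$ for a return carrying $\sigma$ (undefined if anything is undefined). $H$ is balanced from $l$ if $[\![H]\!]^\sharp l$ is defined; an interface set is a set of pairs $(l,H)$ with $H$ balanced from $l$. $H\sqsubseteq H'$ iff there is a bijection $\rho$ from positions of $H$ to those of $H'$ with $H(i)=H'(\rho(i))$ and, for $i<j$, if $H(i),H(j)$ are by the same thread or $H(i)$ is a return and $H(j)$ a call, then $\rho(i)<\rho(j)$. $(l,H)\sqsubseteq(l',H')$ iff $l'\preceq l$ and $H\sqsubseteq H'$; for interface sets, $\mathcal{H}_1\sqsubseteq\mathcal{H}_2$ iff every element of $\mathcal{H}_1$ is $\sqsubseteq$ some element of $\mathcal{H}_2$. Primitive commands have transformers $f^t_c:\Sigma\to\mathcal{P}(\Sigma)\cup\{\top\}$ ($\top$ = fault) satisfying Footprint Preservation ($\sigma'\in f^t_c(\sigma)\Rightarrow\delta(\sigma')=\delta(\sigma)$) and Strong Locality (if $(\sigma_1*\sigma_2)\downarrow$ and $f^t_c(\sigma_1)\ne\top$ then $f^t_c(\sigma_1*\sigma_2)=f^t_c(\sigma_1)*\{\sigma_2\}$). Programs. Commands $C::=c\mid m\mid C;C\mid C+C\mid C^*$. Library $\mathcal{L}=\{m=C_m\mid m\in M\}$ (bodies contain no method calls); client $\mathcal{C}=\mathsf{let}\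 [-]\ \mathsf{in}\ C_1\|\cdots\|C_n$; $\mathcal{C}(\mathcal{L})=\mathsf{let}\ \mathcal{L}\ \mathsf{in}\ C_1\|\cdots\|C_n$. A predicate $r\subseteq\Sigma$ is precise if every $\sigma$ has at most one $\sigma_1\in r$ with $\sigma=\sigma_1*\sigma_2$; then $\sigma\setminus r=\sigma_2$. Parameterised predicates map threads $t$ to predicates $p_t$. A method specification $\Gamma$ is a set of triples $\{p\}m\{q\}$ (at most one per method), $p,q$ precise parameterised predicates (state transferred at call/return by thread $t$). Specified programs: $\mathcal{L}:\Gamma$, $\Gamma\vdash\mathcal{C}$. Traces. Actions: $(t,c)$, $(t,\mathsf{call}\,m)$, $(t,\mathsf{ret}\,m)$ and annotated interface actions. A trace is a finite sequence of actions whose per-thread calls/returns alternate over matching methods starting with a call. $\tau(i)=(t,c)$ is a library action if some earlier $(t,\mathsf{call}\,\_)$ has no $(t,\mathsf{ret}\,\_)$ between it and $i$, otherwise a client action. $\mathsf{client}(\tau)$: projection to client actions and calls/returns; $\mathsf{history}(\tau)$: projection to calls/returns; $\mathsf{ground}$ erases annotations. Client traces $\kappa,\kappa'$ are equivalent, $\kappa\sim\kappa'$, if $\kappa|_t=\kappa'|_t$ for every thread $t$ and their projections to non-interface actions are identical. Trace sets: $[c]_t\eta=\{(t,c)\}$, $[C_1+C_2]_t\eta=\cup$, $[C^*]_t\eta=([C]_t\eta)^*$, $[m]_t\eta=\{(t,\mathsf{call}\,m)\tau(t,\mathsf{ret}\,m)\mid\tau\in\eta(m,t)\}$, $[C_1;C_2]_t\eta$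 = concatenations, $[C_1\|\cdots\|C_n]\eta$ = traces with actions only by threads $1..n$ whose projection to $t$ lies in $[C_t]_t\eta$. Trace set of $\mathcal{C}(\mathcal{L})$: prefix closure of $[C_1\|\cdots\|C_n]\eta$, $\eta(m,t)=[C_m]_t$; of $\Gamma\vdash\mathcal{C}$: same with $\eta(m,t)=\{\varepsilon\}$; of $\mathcal{L}:\Gamma$ with methods $m_1..m_j$: prefix closure of $\bigcup_{k\ge1}$ of $k$ parallel copies of $(m_1+\cdots+m_j)^*$ with $\eta(m,t)=[C_m]_t$. Evaluation of an action from $\sigma$ (a set of (state, annotated action) pairs, or $\top$): $(t,c)$: $\top$ if $f^t_c(\sigma)=\top$, else $\{(\sigma',(t,c))\mid\sigma'\in f^t_c(\sigma)\}$. In complete programs (and for unspecified methods) calls/returns give $\{(\sigma,\varphi)\}$. Library-local, for $\{p\}m\{q\}\in\Gamma$: a call gives $\{(\sigma*\sigma_p,(t,\mathsf{call}\,m(\sigma_p)))\mid\sigma_p\in p_t,(\sigma*\sigma_p)\downarrow\}$; a return gives $\top$ if $\sigma\setminus q_t$ undefined, else $\{(\sigma\setminus q_t,(t,\mathsf{ret}\,m(\sigma_q)))\}$, $\sigma_q\in q_t$ the unique substate. Client-local: a call gives $\top$ if $\sigma\setminus p_t$ undefined, else $\{(\sigma\setminus p_t,(t,\mathsf{call}\,m(\sigma_p)))\}$; a return gives $\{(\sigma*\sigma_q,(t,\mathsf{ret}\,m(\sigma_q)))\mid\sigma_q\in q_t,(\sigma*\sigma_q)\downarrow\}$. Traces are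 evaluated step by step, yielding $\top$ if any step from a reachable state yields $\top$. $[\![P]\!]\sigma=\top$ if some trace of $P$ evaluates to $\top$ from $\sigma$, else the set of resulting annotated traces. Safe at $\sigma$: $[\![P]\!]\sigma\ne\top$; safe for $I$: at all $\sigma\in I$. $[\![P,I]\!]=\{(\sigma,\tau)\mid\sigma\in I,\tau\in[\![P]\!]\sigma\}$. $\mathsf{interf}(\mathcal{L}:\Gamma,I)=\{(\delta(\sigma_0),\mathsf{history}(\tau))\mid(\sigma_0,\tau)\in[\![\mathcal{L}:\Gamma,I]\!]\}$ and $(\mathcal{L}:\Gamma,I)\sqsubseteq\mathcal{H}_2$ iff $\mathsf{interf}(\mathcal{L}:\Gamma,I)\sqsubseteq\mathcal{H}_2$. *)

theory Defs
  imports Main "HOL-Library.Sublist"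
begin

section \<open>Separation algebras and footprints\<close>

text \<open>A result \<open>None\<close> of \<open>\<odot>\<close> means that the product is undefined.  The equation of
  \<^verbatim>\<open>sep_assoc\<close> says that both sides are defined and equal, or both are undefined.\<close>

class sep_algebra =
  fixes sep_mult :: "'a \<Rightarrow> 'a \<Rightarrow> 'a option" (infixl "\<odot>" 70)
    and sep_unit :: "'a"
  assumes sep_comm: "a \<odot> b = b \<odot> a"
    and sep_assoc: "Option.bind (a \<odot> b) (\<lambda>x. x \<odot> c) = Option.bind (b \<odot> c) (\<lambda>y. a \<odot> y)"
    and sep_unit_left: "sep_unit \<odot> a = Some a"
    and sep_cancel: "a \<odot> b = Some x \<Longrightarrow> a \<odot> c = Some x \<Longrightarrow> b = c"

definition (in sep_algebra) fp :: "'a \<Rightarrow> 'a set" where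
  "fp s = {s'. \<forall>u. s' \<odot> u \<noteq> None \<longleftrightarrow> s \<odot> u \<noteq> None}"

class footprint_sep_algebra = sep_algebra +
  assumes fp_cancel:
    "a \<odot> b = Some x \<Longrightarrow> a' \<odot> b' = Some x' \<Longrightarrow> fp x = fp x' \<Longrightarrow> fp a = fp a' \<Longrightarrow> fp b = fp b'"

definition sep_prod :: "'s::sep_algebra set \<Rightarrow> 's set \<Rightarrow> 's set" where
  "sep_prod p q = {s. \<exists>s1\<in>p. \<exists>s2\<in>q. s1 \<odot> s2 = Some s}"

text \<open>Footprints are the elements of \<open>range fp\<close>.  The operations \<open>\<circ>\<close> and \<open>\<setminus>\<setminus>\<close> do not depend
  on the representatives, for \<open>\<setminus>\<setminus>\<close> because of cancellativity on footprints, so that the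
  described footprints are unique.  Note the argument order: \<open>fp_minus l2 l1\<close> is
  \<open>l2 \<setminus>\<setminus> l1\<close>.\<close>

definition fp_comp :: "'s::footprint_sep_algebra set \<Rightarrow> 's set \<Rightarrow> 's set option" where
  "fp_comp l1 l2 =
    (if \<exists>s1 s2 s. l1 = fp s1 \<and> l2 = fp s2 \<and> s1 \<odot> s2 = Some s
     then Some (THE l. \<exists>s1 s2 s. l1 = fp s1 \<and> l2 = fp s2 \<and> s1 \<odot> s2 = Some s \<and> l = fp s)
     else None)"

definition fp_minus :: "'s::footprint_sep_algebra set \<Rightarrow> 's set \<Rightarrow> 's set option" where
  "fp_minus l2 l1 =
    (if \<exists>s1 s2 s. l1 = fp s1 \<and> l2 = fp s2 \<and> s1 \<odot> s = Some s2
     then Some (THE l. \<exists>s1 s2 s. l1 = fp s1 \<and> l2 = fp s2 \<and> s1 \<odot> s = Some s2 \<and> l = fp s)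
     else None)"

definition fp_le :: "'s::footprint_sep_algebra set \<Rightarrow> 's set \<Rightarrow> bool" where
  "fp_le l1 l2 \<longleftrightarrow> fp_minus l2 l1 \<noteq> None"


section \<open>Actions, traces and histories\<close>

text \<open>\<open>Call m None\<close> and \<open>Ret m None\<close> are plain calls and returns, \<open>Call m (Some \<sigma>)\<close> and
  \<open>Ret m (Some \<sigma>)\<close> are interface actions annotated with the transferred state.\<close>

datatype ('c, 'm, 's) act =
    is_exec: Exec 'c
  | is_call: Call 'm "'s option"
  | is_ret: Ret 'm "'s option"

type_synonym thread = nat
type_synonym ('c, 'm, 's) action = "thread \<times> ('c, 'm, 's) act"
type_synonym ('c, 'm, 's) trace = "('c, 'm, 's) action list"

abbreviation is_interface :: "('c, 'm, 's) act \<Rightarrow> bool" where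
  "is_interface a \<equiv> is_call a \<or> is_ret a"

fun annotated :: "('c, 'm, 's) act \<Rightarrow> bool" where
  "annotated (Exec c) \<longleftrightarrow> False"
| "annotated (Call m x) \<longleftrightarrow> x \<noteq> None"
| "annotated (Ret m x) \<longleftrightarrow> x \<noteq> None"

fun erase :: "('c, 'm, 's) act \<Rightarrow> ('c, 'm, 's) act" where
  "erase (Exec c) = Exec c"
| "erase (Call m x) = Call m None"
| "erase (Ret m x) = Ret m None"

definition proj :: "thread \<Rightarrow> ('c, 'm, 's) trace \<Rightarrow> ('c, 'm, 's) trace" where
  "proj t \<tau> = filter (\<lambda>a. fst a = t) \<tau>"

definition history :: "('c, 'm, 's) trace \<Rightarrow> ('c, 'm, 's) trace" where
  "history \<tau> = filter (\<lambda>a. is_interface (snd a)) \<tau>"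

definition ground :: "('c, 'm, 's) trace \<Rightarrow> ('c, 'm, 's) trace" where
  "ground \<tau> = map (\<lambda>(t, a). (t, erase a)) \<tau>"

fun alternating :: "('c, 'm, 's) act list \<Rightarrow> bool" where
  "alternating [] = True"
| "alternating [Call m x] = True"
| "alternating (Call m x # Ret m' y # as) = (m = m' \<and> alternating as)"
| "alternating _ = False"

definition is_trace :: "('c, 'm, 's) trace \<Rightarrow> bool" where
  "is_trace \<tau> \<longleftrightarrow> (\<forall>t. alternating (map snd (proj t (history \<tau>))))"

definition is_history :: "('c, 'm, 's) trace \<Rightarrow> bool" where
  "is_history H \<longleftrightarrow> (\<forall>a\<in>set H. annotated (snd a)) \<and> is_trace H"

definition library_action :: "('c, 'm, 's) trace \<Rightarrow> nat \<Rightarrow> bool" where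
  "library_action \<tau> i \<longleftrightarrow> i < length \<tau> \<and> is_exec (snd (\<tau> ! i)) \<and>
    (\<exists>j<i. fst (\<tau> ! j) = fst (\<tau> ! i) \<and> is_call (snd (\<tau> ! j)) \<and>
       (\<forall>k. j < k \<and> k < i \<longrightarrow> \<not> (fst (\<tau> ! k) = fst (\<tau> ! i) \<and> is_ret (snd (\<tau> ! k)))))"

definition client :: "('c, 'm, 's) trace \<Rightarrow> ('c, 'm, 's) trace" where
  "client \<tau> = nths \<tau> {i. \<not> library_action \<tau> i}"

definition client_equiv :: "('c, 'm, 's) trace \<Rightarrow> ('c, 'm, 's) trace \<Rightarrow> bool" (infix "\<sim>" 50) where
  "\<kappa> \<sim> \<kappa>' \<longleftrightarrow> (\<forall>t. proj t \<kappa> = proj t \<kappa>') \<and>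
     filter (\<lambda>a. \<not> is_interface (snd a)) \<kappa> = filter (\<lambda>a. \<not> is_interface (snd a)) \<kappa>'"

fun fp_step :: "'s::footprint_sep_algebra set \<Rightarrow> ('c, 'm, 's) act \<Rightarrow> 's set option" where
  "fp_step l (Call m (Some s)) = fp_comp l (fp s)"
| "fp_step l (Ret m (Some s)) = fp_minus l (fp s)"
| "fp_step l _ = None"

definition fp_eval ::
  "('c, 'm, 's::footprint_sep_algebra) trace \<Rightarrow> 's set \<Rightarrow> 's set option" where
  "fp_eval H l = foldl (\<lambda>x a. Option.bind x (\<lambda>l'. fp_step l' (snd a))) (Some l) H"

definition balanced :: "'s::footprint_sep_algebra set \<Rightarrow> ('c, 'm, 's) trace \<Rightarrow> bool" where
  "balanced l H \<longleftrightarrow> fp_eval H l \<noteq> None"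

definition interface_set :: "('s::footprint_sep_algebra set \<times> ('c, 'm, 's) trace) set \<Rightarrow> bool" where
  "interface_set \<H> \<longleftrightarrow> (\<forall>(l, H)\<in>\<H>. l \<in> range fp \<and> is_history H \<and> balanced l H)"

definition history_le :: "('c, 'm, 's) trace \<Rightarrow> ('c, 'm, 's) trace \<Rightarrow> bool" where
  "history_le H H' \<longleftrightarrow> (\<exists>\<rho>. bij_betw \<rho> {..<length H} {..<length H'} \<and>
     (\<forall>i<length H. H ! i = H' ! \<rho> i) \<and>
     (\<forall>i j. i < j \<and> j < length H \<and>
        (fst (H ! i) = fst (H ! j) \<or> is_ret (snd (H ! i)) \<and> is_call (snd (H ! j)))
        \<longrightarrow> \<rho> i < \<rho> j))"

definition interface_le ::
  "('s::footprint_sep_algebra set \<times> ('c, 'm, 's) trace) set \<Rightarrow>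
   ('s set \<times> ('c, 'm, 's) trace) set \<Rightarrow> bool" where
  "interface_le \<H>1 \<H>2 \<longleftrightarrow> (\<forall>(l, H)\<in>\<H>1. \<exists>(l', H')\<in>\<H>2. fp_le l' l \<and> history_le H H')"


section \<open>Primitive commands\<close>

text \<open>\<open>f t c \<sigma>\<close> is the transformer of the command \<open>c\<close> in thread \<open>t\<close>; here and below, the
  outcome \<open>None\<close> is the fault \<open>\<top>\<close>.\<close>

type_synonym ('c, 's) transformers = "thread \<Rightarrow> 'c \<Rightarrow> 's \<Rightarrow> 's set option"

definition footprint_preserving :: "('c, 's::footprint_sep_algebra) transformers \<Rightarrow> bool" where
  "footprint_preserving f \<longleftrightarrow> (\<forall>t c s S s'. f t c s = Some S \<and> s' \<in> S \<longrightarrow> fp s' = fp s)"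

definition strongly_local :: "('c, 's::footprint_sep_algebra) transformers \<Rightarrow> bool" where
  "strongly_local f \<longleftrightarrow> (\<forall>t c s1 s2 s S. s1 \<odot> s2 = Some s \<and> f t c s1 = Some S \<longrightarrow>
     f t c s = Some (sep_prod S {s2}))"


section \<open>Programs and method specifications\<close>

datatype ('c, 'm) com =
    Prim 'c
  | Invoke 'm
  | Seq "('c, 'm) com" "('c, 'm) com"
  | Choice "('c, 'm) com" "('c, 'm) com"
  | Iter "('c, 'm) com"

fun call_free :: "('c, 'm) com \<Rightarrow> bool" where
  "call_free (Prim c) = True"
| "call_free (Invoke m) = False"
| "call_free (Seq C D) = (call_free C \<and> call_free D)"
| "call_free (Choice C D) = (call_free C \<and> call_free D)"
| "call_free (Iter C) = call_free C"

text \<open>The set of methods of a library is its domain.  A client is the list of its threads: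
  thread \<open>t \<in> {1..n}\<close> runs the command at (zero-based) position \<open>t - 1\<close>.\<close>

type_synonym ('c, 'm) library = "'m \<Rightarrow> ('c, 'm) com option"
type_synonym ('c, 'm) client = "('c, 'm) com list"

definition is_library :: "('c, 'm) library \<Rightarrow> bool" where
  "is_library L \<longleftrightarrow> (\<forall>C\<in>ran L. call_free C)"

definition precise :: "'s::sep_algebra set \<Rightarrow> bool" where
  "precise r \<longleftrightarrow> (\<forall>s s1 s1' s2 s2'. s1 \<in> r \<and> s1' \<in> r \<and> s1 \<odot> s2 = Some s \<and> s1' \<odot> s2' = Some s
     \<longrightarrow> s1 = s1')"

type_synonym 's ppred = "thread \<Rightarrow> 's set"

text \<open>\<open>\<Gamma> m = Some (p, q)\<close> stands for the triple \<open>{p} m {q}\<close>.\<close>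

type_synonym ('m, 's) method_spec = "'m \<Rightarrow> ('s ppred \<times> 's ppred) option"

definition is_method_spec :: "('m, 's::sep_algebra) method_spec \<Rightarrow> bool" where
  "is_method_spec \<Gamma> \<longleftrightarrow>
    (\<forall>m p q. \<Gamma> m = Some (p, q) \<longrightarrow> (\<forall>t. precise (p t) \<and> precise (q t)))"

datatype ('c, 'm, 's) program =
    Complete "('c, 'm) client" "('c, 'm) library"
  | LibLocal "('c, 'm) library" "('m, 's) method_spec"
  | ClientLocal "('m, 's) method_spec" "('c, 'm) client"


section \<open>Trace sets\<close>

definition conc :: "'a list set \<Rightarrow> 'a list set \<Rightarrow> 'a list set" where
  "conc A B = {xs @ ys | xs ys. xs \<in> A \<and> ys \<in> B}"

definition kleene :: "'a list set \<Rightarrow> 'a list set" where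
  "kleene A = {concat xss | xss. set xss \<subseteq> A}"

definition prefix_closure :: "'a list set \<Rightarrow> 'a list set" where
  "prefix_closure A = {xs. \<exists>ys\<in>A. prefix xs ys}"

fun com_traces ::
  "('m \<Rightarrow> thread \<Rightarrow> ('c, 'm, 's) trace set) \<Rightarrow> thread \<Rightarrow> ('c, 'm) com \<Rightarrow> ('c, 'm, 's) trace set"
where
  "com_traces \<eta> t (Prim c) = {[(t, Exec c)]}"
| "com_traces \<eta> t (Invoke m) = {(t, Call m None) # \<tau> @ [(t, Ret m None)] | \<tau>. \<tau> \<in> \<eta> m t}"
| "com_traces \<eta> t (Seq C D) = conc (com_traces \<eta> t C) (com_traces \<eta> t D)"
| "com_traces \<eta> t (Choice C D) = com_traces \<eta> t C \<union> com_traces \<eta> t D"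
| "com_traces \<eta> t (Iter C) = kleene (com_traces \<eta> t C)"

text \<open>Parallel composition of \<open>n\<close> threads, where \<open>T t\<close> is the trace set of thread \<open>t\<close>.\<close>

definition par_traces ::
  "nat \<Rightarrow> (thread \<Rightarrow> ('c, 'm, 's) trace set) \<Rightarrow> ('c, 'm, 's) trace set" where
  "par_traces n T = {\<tau>. is_trace \<tau> \<and> (\<forall>a\<in>set \<tau>. fst a \<in> {1..n}) \<and> (\<forall>t\<in>{1..n}. proj t \<tau> \<in> T t)}"

text \<open>Library bodies do not call methods, hence the environment used for them is irrelevant.
  Methods that the library does not define have no traces.\<close>

definition lib_env :: "('c, 'm) library \<Rightarrow> 'm \<Rightarrow> thread \<Rightarrow> ('c, 'm, 's) trace set" where
  "lib_env L m t = (case L m of None \<Rightarrow> {} | Some C \<Rightarrow> com_traces (\<lambda>_ _. {}) t C)"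

definition client_traces ::
  "('m \<Rightarrow> thread \<Rightarrow> ('c, 'm, 's) trace set) \<Rightarrow> ('c, 'm) client \<Rightarrow> ('c, 'm, 's) trace set" where
  "client_traces \<eta> Cs = par_traces (length Cs) (\<lambda>t. com_traces \<eta> t (Cs ! (t - 1)))"

text \<open>In the trace set of a library, the union over its methods \<open>m\<^sub>1, \<dots>, m\<^sub>j\<close> is the trace set
  of \<open>m\<^sub>1 + \<cdots> + m\<^sub>j\<close>.\<close>

fun traces :: "('c, 'm, 's) program \<Rightarrow> ('c, 'm, 's) trace set" where
  "traces (Complete Cs L) = prefix_closure (client_traces (lib_env L) Cs)"
| "traces (ClientLocal \<Gamma> Cs) = prefix_closure (client_traces (\<lambda>_ _. {[]}) Cs)"
| "traces (LibLocal L \<Gamma>) = prefix_closure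
     (\<Union>k\<in>{1..}. par_traces k (\<lambda>t. kleene (\<Union>m\<in>dom L. com_traces (lib_env L) t (Invoke m))))"


section \<open>Evaluation\<close>

text \<open>By cancellativity, for a precise predicate \<open>r\<close> the set \<open>splits \<sigma> r\<close> has at most one
  element; it is \<open>(\<sigma>\<^sub>1, \<sigma> \<setminus> r)\<close> with \<open>\<sigma>\<^sub>1 \<in> r\<close> if \<open>\<sigma> \<setminus> r\<close> is defined, and otherwise the set
  is empty.\<close>

definition splits :: "'s::sep_algebra \<Rightarrow> 's set \<Rightarrow> ('s \<times> 's) set" where
  "splits s r = {(s1, s2). s1 \<in> r \<and> s1 \<odot> s2 = Some s}"

definition give :: "'s::sep_algebra \<Rightarrow> 's set \<Rightarrow> ('s \<Rightarrow> ('c, 'm, 's) action) \<Rightarrow>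
    ('s \<times> ('c, 'm, 's) action) set option" where
  "give s r a = (if splits s r = {} then None else Some {(s2, a s1) | s1 s2. (s1, s2) \<in> splits s r})"

definition receive :: "'s::sep_algebra \<Rightarrow> 's set \<Rightarrow> ('s \<Rightarrow> ('c, 'm, 's) action) \<Rightarrow>
    ('s \<times> ('c, 'm, 's) action) set option" where
  "receive s r a = Some {(s', a s1) | s1 s'. s1 \<in> r \<and> s \<odot> s1 = Some s'}"

fun eval_call :: "('c, 'm, 's::sep_algebra) program \<Rightarrow> 's \<Rightarrow> thread \<Rightarrow> 'm \<Rightarrow>
    ('s \<times> ('c, 'm, 's) action) set option" where
  "eval_call (Complete Cs L) s t m = Some {(s, (t, Call m None))}"
| "eval_call (LibLocal L \<Gamma>) s t m = (case \<Gamma> m of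
      None \<Rightarrow> Some {(s, (t, Call m None))}
    | Some (p, q) \<Rightarrow> receive s (p t) (\<lambda>sp. (t, Call m (Some sp))))"
| "eval_call (ClientLocal \<Gamma> Cs) s t m = (case \<Gamma> m of
      None \<Rightarrow> Some {(s, (t, Call m None))}
    | Some (p, q) \<Rightarrow> give s (p t) (\<lambda>sp. (t, Call m (Some sp))))"

fun eval_ret :: "('c, 'm, 's::sep_algebra) program \<Rightarrow> 's \<Rightarrow> thread \<Rightarrow> 'm \<Rightarrow>
    ('s \<times> ('c, 'm, 's) action) set option" where
  "eval_ret (Complete Cs L) s t m = Some {(s, (t, Ret m None))}"
| "eval_ret (LibLocal L \<Gamma>) s t m = (case \<Gamma> m of
      None \<Rightarrow> Some {(s, (t, Ret m None))}
    | Some (p, q) \<Rightarrow> give s (q t) (\<lambda>sq. (t, Ret m (Some sq))))"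
| "eval_ret (ClientLocal \<Gamma> Cs) s t m = (case \<Gamma> m of
      None \<Rightarrow> Some {(s, (t, Ret m None))}
    | Some (p, q) \<Rightarrow> receive s (q t) (\<lambda>sq. (t, Ret m (Some sq))))"

text \<open>Only ground traces are ever evaluated, so the annotation of the evaluated action plays
  no role.\<close>

fun eval_action :: "('c, 's::sep_algebra) transformers \<Rightarrow> ('c, 'm, 's) program \<Rightarrow> 's \<Rightarrow>
    ('c, 'm, 's) action \<Rightarrow> ('s \<times> ('c, 'm, 's) action) set option" where
  "eval_action f P s (t, Exec c) = map_option (\<lambda>S. {(s', (t, Exec c)) | s'. s' \<in> S}) (f t c s)"
| "eval_action f P s (t, Call m x) = eval_call P s t m"
| "eval_action f P s (t, Ret m x) = eval_ret P s t m"

primrec eval_trace :: "('c, 's::sep_algebra) transformers \<Rightarrow> ('c, 'm, 's) program \<Rightarrow>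
    ('c, 'm, 's) trace \<Rightarrow> 's \<Rightarrow> ('s \<times> ('c, 'm, 's) trace) set option" where
  "eval_trace f P [] s = Some {(s, [])}"
| "eval_trace f P (a # \<tau>) s = (case eval_action f P s a of
      None \<Rightarrow> None
    | Some S \<Rightarrow>
        if \<exists>(s', a')\<in>S. eval_trace f P \<tau> s' = None then None
        else Some {(s'', a' # \<tau>') | s'' a' \<tau>'.
                     \<exists>s'. (s', a') \<in> S \<and> (s'', \<tau>') \<in> the (eval_trace f P \<tau> s')})"

definition sem :: "('c, 's::sep_algebra) transformers \<Rightarrow> ('c, 'm, 's) program \<Rightarrow> 's \<Rightarrow>
    ('c, 'm, 's) trace set option" where
  "sem f P s =
    (if \<exists>\<tau>\<in>traces P. eval_trace f P \<tau> s = None then None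
     else Some {\<tau>'. \<exists>\<tau>\<in>traces P. \<exists>s'. (s', \<tau>') \<in> the (eval_trace f P \<tau> s)})"

definition safe :: "('c, 's::sep_algebra) transformers \<Rightarrow> ('c, 'm, 's) program \<Rightarrow> 's set \<Rightarrow> bool" where
  "safe f P I \<longleftrightarrow> (\<forall>s\<in>I. sem f P s \<noteq> None)"

definition sem_on :: "('c, 's::sep_algebra) transformers \<Rightarrow> ('c, 'm, 's) program \<Rightarrow> 's set \<Rightarrow>
    ('s \<times> ('c, 'm, 's) trace) set" where
  "sem_on f P I = {(s, \<tau>). s \<in> I \<and> (\<exists>T. sem f P s = Some T \<and> \<tau> \<in> T)}"

definition interf :: "('c, 's::sep_algebra) transformers \<Rightarrow> ('c, 'm) library \<Rightarrow>
    ('m, 's) method_spec \<Rightarrow> 's set \<Rightarrow> ('s set \<times> ('c, 'm, 's) trace) set" where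
  "interf f L \<Gamma> I = {(fp s0, history \<tau>) | s0 \<tau>. (s0, \<tau>) \<in> sem_on f (LibLocal L \<Gamma>) I}"

end

theory Submission
  imports Defs
begin

text \<open>A run of \<open>\<C>(\<L>\<^sub>1)\<close> from \<open>\<sigma>\<^sub>c * \<sigma>\<^sub>l\<close> splits, by strong locality and safety of the two halves, into a
  client-local run \<open>\<kappa>\<close> from \<open>\<sigma>\<^sub>c\<close> and a library-local run from \<open>\<sigma>\<^sub>l\<close> with the same history \<open>H\<close>.  By
  assumption \<open>H \<sqsubseteq> H'\<close> for some \<open>(l', H') \<in> \<H>\<^sub>2\<close> with \<open>l' \<preceq> \<delta>(\<sigma>\<^sub>l)\<close>.  It remains to rearrange \<open>\<kappa>\<close> into a
  run with history \<open>H'\<close>.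

  Replay \<open>\<kappa>\<close> action by action, emitting the interface actions in the order of \<open>H'\<close>, but as late as
  possible: only when \<open>\<kappa>\<close> reaches a return, emit \<open>H'\<close> up to that return.  Since \<open>H \<sqsubseteq> H'\<close> preserves the
  order of a return and a later call, the replay never emits a call before \<open>\<kappa>\<close> has reached it, so
  its state is always the state of \<open>\<kappa>\<close> extended by the states of pending calls and early returns,
  and commands behave the same by strong locality.  An early return is possible because the client
  state stays compatible with the library footprint obtained by evaluating \<open>H'\<close> from \<open>l'\<close>.\<close>

section \<open>Separation algebras and footprints\<close>

lemma sep_assoc_right:
  assumes "a \<odot> b = Some x" "x \<odot> c = Some y"
  obtains z where "b \<odot> c = Some z" "a \<odot> z = Some y"
  using sep_assoc[of a b c] assms by (cases "b \<odot> c") auto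

lemma sep_assoc_left:
  assumes "b \<odot> c = Some z" "a \<odot> z = Some y"
  obtains x where "a \<odot> b = Some x" "x \<odot> c = Some y"
  using sep_assoc[of a b c] assms by (cases "a \<odot> b") auto

lemma sep_unit_right: "a \<odot> sep_unit = Some a"
  using sep_comm sep_unit_left by metis

lemma fp_eq_defined: "fp a = fp b \<Longrightarrow> a \<odot> u \<noteq> None \<longleftrightarrow> b \<odot> u \<noteq> None"
proof -
  assume "fp a = fp b"
  moreover have "a \<in> fp a" by (simp add: fp_def)
  ultimately have "a \<in> fp b" by simp
  then show ?thesis by (simp add: fp_def)
qed

lemma fp_eq_defined_right: "fp a = fp b \<Longrightarrow> u \<odot> a \<noteq> None \<longleftrightarrow> u \<odot> b \<noteq> None"
  using fp_eq_defined[of a b u] by (simp add: sep_comm)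

lemma fp_eqI: "(\<And>u. a \<odot> u \<noteq> None \<longleftrightarrow> b \<odot> u \<noteq> None) \<Longrightarrow> fp a = fp b"
  by (simp add: fp_def)

text \<open>By associativity \<open>x \<odot> u\<close> is \<open>a\<close> times
  \<open>b \<odot> u\<close>, and whether such a product is defined depends only on
  \<open>fp a\<close>.\<close>

lemma fp_mult_cong_left:
  assumes "fp a = fp a'" "a \<odot> b = Some x" "a' \<odot> b = Some x'"
  shows "fp x = fp x'"
proof (rule fp_eqI)
  fix u
  have "x \<odot> u = Option.bind (b \<odot> u) (\<lambda>y. a \<odot> y)" "x' \<odot> u = Option.bind (b \<odot> u) (\<lambda>y. a' \<odot> y)"
    using sep_assoc[of a b u] sep_assoc[of a' b u] assms by auto
  then show "x \<odot> u \<noteq> None \<longleftrightarrow> x' \<odot> u \<noteq> None"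
    using fp_eq_defined[OF assms(1)] by (cases "b \<odot> u") auto
qed

lemma fp_mult_cong:
  assumes "fp a = fp a'" "fp b = fp b'" "a \<odot> b = Some x" "a' \<odot> b' = Some x'"
  shows "fp x = fp x'"
proof -
  obtain y where y: "a' \<odot> b = Some y"
    using fp_eq_defined[OF assms(1), of b] assms(3) by auto
  have "fp x = fp y" using fp_mult_cong_left assms(1,3) y by blast
  moreover have "fp y = fp x'"
    using fp_mult_cong_left[OF assms(2), of a'] y assms(4) by (simp add: sep_comm)
  ultimately show ?thesis by simp
qed

text \<open>The congruence makes the definite description in \<open>fp_comp\<close> unique, so any
  representatives may be used. For \<open>fp_minus\<close> below, cancellativity on footprints has
  the same effect.\<close>

lemma fp_comp_fp:
  assumes "a \<odot> b = Some x"
  shows "fp_comp (fp a) (fp b) = Some (fp x)"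
proof -
  have "(THE l. \<exists>s1 s2 s. fp a = fp s1 \<and> fp b = fp s2 \<and> s1 \<odot> s2 = Some s \<and> l = fp s) = fp x"
    using assms fp_mult_cong by (intro the_equality) blast+
  then show ?thesis using assms unfolding fp_comp_def by auto
qed

lemma fp_minus_fp:
  assumes "a \<odot> b = Some x"
  shows "fp_minus (fp x) (fp a) = Some (fp b)"
proof -
  have "(THE l. \<exists>s1 s2 s. fp a = fp s1 \<and> fp x = fp s2 \<and> s1 \<odot> s = Some s2 \<and> l = fp s) = fp b"
    using assms fp_cancel by (intro the_equality) blast+
  then show ?thesis using assms unfolding fp_minus_def by auto
qed

lemma fp_minusE:
  assumes "fp_minus l2 l1 \<noteq> None"
  obtains a b x where "l1 = fp a" "l2 = fp x" "a \<odot> b = Some x"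
  using assms unfolding fp_minus_def by (auto split: if_splits)

text \<open>Iterated separating product over a finite index set, encoded as a relation because it
  may be undefined.\<close>

inductive sep_big :: "('i \<Rightarrow> 's::sep_algebra) \<Rightarrow> 'i set \<Rightarrow> 's \<Rightarrow> bool" for g where
  sep_big_empty: "sep_big g {} sep_unit"
| sep_big_insert: "sep_big g A z \<Longrightarrow> k \<notin> A \<Longrightarrow> g k \<odot> z = Some z' \<Longrightarrow> sep_big g (insert k A) z'"

text \<open>Commutativity and associativity make the order of insertion immaterial, so any factor
  can be regarded as the last one inserted.\<close>

lemma sep_big_remove:
  assumes "sep_big g A z" "k \<in> A"
  shows "\<exists>z'. sep_big g (A - {k}) z' \<and> g k \<odot> z' = Some z"
  using assms
proof (induction arbitrary: k)
  case sep_big_empty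
  then show ?case by simp
next
  case (sep_big_insert A z j z')
  show ?case
  proof (cases "k = j")
    case True
    then show ?thesis using sep_big_insert by auto
  next
    case False
    then obtain w where w: "sep_big g (A - {k}) w" "g k \<odot> w = Some z"
      using sep_big_insert by blast
    \<comment> \<open>Here the outermost factor \<open>g j\<close> is exchanged with
      \<open>g k\<close>.\<close>
    obtain x where x: "g j \<odot> g k = Some x" "x \<odot> w = Some z'"
      using sep_assoc_left w(2) sep_big_insert.hyps(3) by blast
    then obtain v where v: "g j \<odot> w = Some v" "g k \<odot> v = Some z'"
      using sep_assoc_right[of "g k" "g j"] by (metis sep_comm)
    have "sep_big g (insert j (A - {k})) v"
      using sep_big.sep_big_insert[OF w(1) _ v(1)] sep_big_insert.hyps(2) by blast
    moreover have "insert j (A - {k}) = insert j A - {k}" using False by blast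
    ultimately show ?thesis using v(2) by auto
  qed
qed

section \<open>Runs\<close>

text \<open>The outcomes of \<open>eval_trace\<close> with faulting branches left out. Faults are
  handled separately, so that outcomes can be discussed without case distinctions on
  \<open>None\<close>.\<close>

primrec runs :: "('c, 's::sep_algebra) transformers \<Rightarrow> ('c, 'm, 's) program \<Rightarrow>
    ('c, 'm, 's) trace \<Rightarrow> 's \<Rightarrow> ('s \<times> ('c, 'm, 's) trace) set" where
  "runs f P [] s = {(s, [])}"
| "runs f P (a # \<tau>) s = {(s'', a' # \<tau>') | s'' a' \<tau>'.
     \<exists>S s'. eval_action f P s a = Some S \<and> (s', a') \<in> S \<and> (s'', \<tau>') \<in> runs f P \<tau> s'}"

lemma eval_trace_runs: "eval_trace f P \<tau> s = Some S \<Longrightarrow> S = runs f P \<tau> s"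
proof (induction \<tau> arbitrary: s S)
  case (Cons a \<tau>)
  from Cons.prems obtain A where A: "eval_action f P s a = Some A"
    and ok: "\<forall>(s', a')\<in>A. eval_trace f P \<tau> s' \<noteq> None"
    and S: "S = {(s'', a' # \<tau>') | s'' a' \<tau>'.
                     \<exists>s'. (s', a') \<in> A \<and> (s'', \<tau>') \<in> the (eval_trace f P \<tau> s')}"
    by (fastforce split: option.splits if_splits)
  have "the (eval_trace f P \<tau> s') = runs f P \<tau> s'" if "(s', a') \<in> A" for s' a'
    using ok that Cons.IH[of s'] by fastforce
  then have "(\<exists>s'. (s', a') \<in> A \<and> (s'', \<tau>') \<in> the (eval_trace f P \<tau> s')) \<longleftrightarrow>
      (\<exists>s'. (s', a') \<in> A \<and> (s'', \<tau>') \<in> runs f P \<tau> s')" for s'' a' \<tau>'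
    by blast
  then show ?case using A S by simp
qed simp

lemma eval_trace_Cons_None: "eval_trace f P (a # \<tau>) s = None \<longleftrightarrow>
    (case eval_action f P s a of None \<Rightarrow> True | Some S \<Rightarrow> \<exists>(s', a')\<in>S. eval_trace f P \<tau> s' = None)"
  by (auto split: option.splits)

text \<open>The recursion of \<open>eval_trace\<close> consumes the first action, whereas the
  simulations below extend a prefix. This form isolates the fault that the last action can
  add.\<close>

lemma eval_trace_snoc_None:
  "eval_trace f P (\<tau> @ [a]) s = None \<longleftrightarrow>
    eval_trace f P \<tau> s = None \<or> (\<exists>(s', \<tau>')\<in>runs f P \<tau> s. eval_action f P s' a = None)"
proof (induction \<tau> arbitrary: s)
  case Nil
  then show ?case by (auto split: option.splits)
next
  case (Cons b \<tau>)
  show ?case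
  proof (cases "eval_action f P s b")
    case None
    then show ?thesis by simp
  next
    case (Some S)
    then have "eval_trace f P ((b # \<tau>) @ [a]) s = None \<longleftrightarrow>
        (\<exists>(s', a')\<in>S. eval_trace f P (\<tau> @ [a]) s' = None)"
      unfolding append_Cons eval_trace_Cons_None by simp
    also have "\<dots> \<longleftrightarrow> (\<exists>(s', a')\<in>S. eval_trace f P \<tau> s' = None) \<or>
        (\<exists>(s', a')\<in>S. \<exists>(s'', \<tau>')\<in>runs f P \<tau> s'. eval_action f P s'' a = None)"
      unfolding Cons.IH by blast
    also have "(\<exists>(s', a')\<in>S. eval_trace f P \<tau> s' = None) \<longleftrightarrow> eval_trace f P (b # \<tau>) s = None"
      unfolding eval_trace_Cons_None Some by simp
    also have "(\<exists>(s', a')\<in>S. \<exists>(s'', \<tau>')\<in>runs f P \<tau> s'. eval_action f P s'' a = None) \<longleftrightarrow>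
        (\<exists>(s', \<tau>')\<in>runs f P (b # \<tau>) s. eval_action f P s' a = None)"
      using Some by fastforce
    finally show ?thesis .
  qed
qed

lemma runs_snoc:
  "(s'', \<tau>'') \<in> runs f P (\<tau> @ [a]) s \<longleftrightarrow> (\<exists>s' \<tau>' a' S. (s', \<tau>') \<in> runs f P \<tau> s \<and>
     eval_action f P s' a = Some S \<and> (s'', a') \<in> S \<and> \<tau>'' = \<tau>' @ [a'])"
proof (induction \<tau> arbitrary: s \<tau>'')
  case Nil
  then show ?case by auto
next
  case (Cons b \<tau>)
  show ?case (is "?L \<longleftrightarrow> ?R")
  proof
    assume ?L
    then show ?R by (simp add: Cons.IH) (metis append_Cons)
  next
    assume ?R
    then show ?L by (simp add: Cons.IH) fastforce
  qed
qed

section \<open>Safety and semantics in terms of runs\<close>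

lemma safe_eval_trace:
  "safe f P I \<Longrightarrow> s \<in> I \<Longrightarrow> \<tau> \<in> traces P \<Longrightarrow> eval_trace f P \<tau> s \<noteq> None"
  unfolding safe_def sem_def by (auto split: if_splits)

lemma safeI:
  "(\<And>s \<tau>. s \<in> I \<Longrightarrow> \<tau> \<in> traces P \<Longrightarrow> eval_trace f P \<tau> s \<noteq> None) \<Longrightarrow> safe f P I"
  unfolding safe_def sem_def by auto

lemma sem_on_safe:
  assumes "safe f P I"
  shows "(s, \<tau>') \<in> sem_on f P I \<longleftrightarrow>
    s \<in> I \<and> (\<exists>\<tau>\<in>traces P. \<exists>s'. (s', \<tau>') \<in> runs f P \<tau> s)"
proof (cases "s \<in> I")
  case True
  have *: "the (eval_trace f P \<tau> s) = runs f P \<tau> s" if "\<tau> \<in> traces P" for \<tau>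
    using safe_eval_trace[OF assms True that] eval_trace_runs by fastforce
  have "sem f P s = Some {\<tau>'. \<exists>\<tau>\<in>traces P. \<exists>s'. (s', \<tau>') \<in> the (eval_trace f P \<tau> s)}"
    using safe_eval_trace[OF assms True] unfolding sem_def by auto
  then show ?thesis using True * by (auto simp: sem_on_def)
qed (simp add: sem_on_def)

lemma prefix_closure_prefix:
  "prefix xs ys \<Longrightarrow> ys \<in> prefix_closure A \<Longrightarrow> xs \<in> prefix_closure A"
  unfolding prefix_closure_def using prefix_order.trans by blast

lemma traces_prefix: "prefix \<tau> \<tau>' \<Longrightarrow> \<tau>' \<in> traces P \<Longrightarrow> \<tau> \<in> traces P"
  by (cases P) (auto intro: prefix_closure_prefix simp del: UN_simps)

lemma safe_eval_action:
  assumes "safe f P I" "s \<in> I" "\<tau> @ [a] \<in> traces P" "(s', \<tau>') \<in> runs f P \<tau> s"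
  shows "eval_action f P s' a \<noteq> None"
  using safe_eval_trace[OF assms(1-3)] assms(4) by (auto simp: eval_trace_snoc_None)

lemma eval_action_erase: "eval_action f P s (t, erase a) = eval_action f P s (t, a)"
  by (cases a) auto

text \<open>Evaluation ignores the annotations of its input, so an annotated trace can be fed back
  as the trace to evaluate. Later, runs carry the same trace as input and output.\<close>

lemma runs_ground: "runs f P (ground \<tau>) s = runs f P \<tau> s"
  by (induction \<tau> arbitrary: s) (auto simp: ground_def eval_action_erase)

lemma eval_action_ground:
  "eval_action f P s (t, a) = Some S \<Longrightarrow> (s', (t', a')) \<in> S \<Longrightarrow> t' = t \<and> erase a' = erase a"
  by (cases a; cases P) (auto simp: give_def receive_def split: option.splits if_splits)

lemma runs_ground_eq: "(s', \<tau>') \<in> runs f P \<tau> s \<Longrightarrow> ground \<tau>' = ground \<tau>"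
proof (induction \<tau> arbitrary: s \<tau>')
  case (Cons a \<tau>)
  then show ?case by (cases a) (force simp: ground_def dest: eval_action_ground)
qed simp

section \<open>Projections of traces\<close>

lemma proj_simps [simp]:
  "proj t [] = []"
  "proj t (a # \<tau>) = (if fst a = t then a # proj t \<tau> else proj t \<tau>)"
  "proj t (\<tau> @ \<tau>') = proj t \<tau> @ proj t \<tau>'"
  by (auto simp: proj_def)

lemma history_simps [simp]:
  "history [] = []"
  "history (a # \<tau>) = (if is_interface (snd a) then a # history \<tau> else history \<tau>)"
  "history (\<tau> @ \<tau>') = history \<tau> @ history \<tau>'"
  by (auto simp: history_def)

lemma ground_simps [simp]:
  "ground [] = []"
  "ground (a # \<tau>) = (fst a, erase (snd a)) # ground \<tau>"
  "ground (\<tau> @ \<tau>') = ground \<tau> @ ground \<tau>'"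
  by (auto simp: ground_def split: prod.splits)

lemma not_interface_iff_exec: "\<not> is_interface a \<longleftrightarrow> is_exec a"
  by (cases a) auto

lemma proj_history: "proj t (history \<tau>) = history (proj t \<tau>)"
  by (induction \<tau>) auto

lemma proj_ground: "proj t (ground \<tau>) = ground (proj t \<tau>)"
  by (induction \<tau>) auto

lemma erase_is_simps [simp]:
  "is_exec (erase a) = is_exec a" "is_call (erase a) = is_call a" "is_ret (erase a) = is_ret a"
  by (cases a; simp)+

lemma ground_eq_iff: "ground \<tau> = \<tau> \<longleftrightarrow> (\<forall>a\<in>set \<tau>. erase (snd a) = snd a)"
  by (induction \<tau>) (auto simp: prod_eq_iff)

lemma history_ground: "history (ground \<tau>) = ground (history \<tau>)"
  by (induction \<tau>) auto

lemma filter_not_interface_ground: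
  "filter (\<lambda>a. \<not> is_interface (snd a)) (ground \<tau>) =
    ground (filter (\<lambda>a. \<not> is_interface (snd a)) \<tau>)"
  by (induction \<tau>) auto

lemma map_snd_ground: "map snd (ground \<tau>) = map erase (map snd \<tau>)"
  by (induction \<tau>) auto

lemma alternating_map_erase: "alternating (map erase as) \<longleftrightarrow> alternating as"
  by (induction as rule: alternating.induct) auto

lemma is_trace_ground: "is_trace (ground \<tau>) \<longleftrightarrow> is_trace \<tau>"
  unfolding is_trace_def
  by (simp only: history_ground proj_ground map_snd_ground alternating_map_erase)

lemma runs_Complete: "(s', \<tau>') \<in> runs f (Complete Cs L) \<tau> s \<Longrightarrow> \<tau>' = ground \<tau>"
proof (induction \<tau> arbitrary: s \<tau>')
  case (Cons a \<tau>)
  then show ?case by (cases a; cases "snd a") auto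
qed simp

text \<open>\<open>B t\<close> records whether thread \<open>t\<close> is executing a method.\<close>

fun upd_busy :: "(thread \<Rightarrow> bool) \<Rightarrow> ('c, 'm, 's) action \<Rightarrow> thread \<Rightarrow> bool" where
  "upd_busy B (t, Exec c) = B"
| "upd_busy B (t, Call m x) = B(t := True)"
| "upd_busy B (t, Ret m x) = B(t := False)"

definition busy :: "(thread \<Rightarrow> bool) \<Rightarrow> ('c, 'm, 's) trace \<Rightarrow> thread \<Rightarrow> bool" where
  "busy B \<tau> = foldl upd_busy B \<tau>"

lemma busy_simps [simp]:
  "busy B [] = B" "busy B (a # \<tau>) = busy (upd_busy B a) \<tau>"
  "busy B (\<tau> @ \<tau>') = busy (busy B \<tau>) \<tau>'"
  by (simp_all add: busy_def)

text \<open>\<open>part False\<close> keeps the interface and client actions, \<open>part True\<close> the interface and library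
  actions.\<close>

primrec part :: "bool \<Rightarrow> (thread \<Rightarrow> bool) \<Rightarrow> ('c, 'm, 's) trace \<Rightarrow> ('c, 'm, 's) trace" where
  "part k B [] = []"
| "part k B (a # \<tau>) =
     (if is_exec (snd a) \<and> B (fst a) \<noteq> k then [] else [a]) @ part k (upd_busy B a) \<tau>"

lemma part_append [simp]: "part k B (\<tau> @ \<tau>') = part k B \<tau> @ part k (busy B \<tau>) \<tau>'"
  by (induction \<tau> arbitrary: B) auto

lemma upd_busy_eq: "upd_busy B a t = (if fst a = t then (if is_exec (snd a) then B t else is_call (snd a)) else B t)"
  by (cases "(B, a)" rule: upd_busy.cases) auto

text \<open>What happens to the actions of \<open>t\<close> depends on the busy map at
  \<open>t\<close> alone. Agreement of \<open>B\<close> and \<open>B'\<close> is asked only there,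
  because the actions of other threads update one of the two maps and not the other.\<close>

lemma proj_part: "B t = B' t \<Longrightarrow> proj t (part k B \<tau>) = part k B' (proj t \<tau>)"
proof (induction \<tau> arbitrary: B B')
  case (Cons a \<tau>)
  have "upd_busy B a t = (if fst a = t then upd_busy B' a else B') t"
    using Cons.prems by (simp add: upd_busy_eq)
  then have "proj t (part k (upd_busy B a) \<tau>) =
      part k (if fst a = t then upd_busy B' a else B') (proj t \<tau>)"
    by (rule Cons.IH)
  then show ?case using Cons.prems by auto
qed simp

lemma busy_ground [simp]: "busy B (ground \<tau>) = busy B \<tau>"
proof (induction \<tau> arbitrary: B)
  case (Cons a \<tau>)
  have "upd_busy B (fst a, erase (snd a)) = upd_busy B a"
    by (cases a; cases "snd a") auto
  then show ?case using Cons by simp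
qed simp

lemma set_part: "set (part k B \<tau>) \<subseteq> set \<tau>"
  by (induction \<tau> arbitrary: B) auto

lemma part_prefix: "prefix \<tau> \<tau>' \<Longrightarrow> prefix (part k B \<tau>) (part k B \<tau>')"
  by (auto simp: prefix_def)

text \<open>Dropped library commands leave the busy map unchanged, so a prefix of the kept part
  yields the same map as the corresponding prefix of \<open>\<tau>\<close>; a command is kept only
  where its thread is not busy.\<close>

lemma part_False_exec:
  assumes "part False B \<tau> = \<kappa> @ (t, a) # \<kappa>'" "is_exec a"
  shows "\<not> busy B \<kappa> t"
  using assms(1)
proof (induction \<tau> arbitrary: B \<kappa>)
  case (Cons b \<tau>)
  obtain u x where b: "b = (u, x)" by fastforce
  show ?case
  proof (cases "is_exec x \<and> B u")
    case True
    moreover from True have "upd_busy B b = B" using b by (cases x) auto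
    ultimately show ?thesis using Cons b by simp
  next
    case False
    show ?thesis
    proof (cases \<kappa>)
      case Nil
      then show ?thesis using False Cons.prems b assms(2) by auto
    next
      case (Cons b' \<kappa>1)
      then have "b' = b" "part False (upd_busy B b) \<tau> = \<kappa>1 @ (t, a) # \<kappa>'"
        using False Cons.prems b by auto
      then show ?thesis using Cons.IH Cons by simp
    qed
  qed
qed simp

text \<open>Connects the folded busy map with the search for an unreturned call in
  \<open>library_action\<close>.\<close>

lemma busy_iff_nth: "busy (\<lambda>_. False) \<tau> t \<longleftrightarrow> (\<exists>j<length \<tau>. fst (\<tau> ! j) = t \<and> is_call (snd (\<tau> ! j)) \<and>
    (\<forall>k. j < k \<and> k < length \<tau> \<longrightarrow> \<not> (fst (\<tau> ! k) = t \<and> is_ret (snd (\<tau> ! k)))))"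
proof (induction \<tau> rule: rev_induct)
  case (snoc a \<tau>)
  let ?Q = "\<lambda>\<tau> j. fst (\<tau> ! j) = t \<and> is_call (snd (\<tau> ! j)) \<and>
    (\<forall>k. j < k \<and> k < length \<tau> \<longrightarrow> \<not> (fst (\<tau> ! k) = t \<and> is_ret (snd (\<tau> ! k))))"
  have "(\<exists>j<length (\<tau> @ [a]). ?Q (\<tau> @ [a]) j) \<longleftrightarrow>
      (\<exists>j<length \<tau>. ?Q (\<tau> @ [a]) j) \<or> ?Q (\<tau> @ [a]) (length \<tau>)"
    by (auto simp: less_Suc_eq)
  also have "?Q (\<tau> @ [a]) (length \<tau>) \<longleftrightarrow> fst a = t \<and> is_call (snd a)" by auto
  also have "(\<exists>j<length \<tau>. ?Q (\<tau> @ [a]) j) \<longleftrightarrow>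
      (\<exists>j<length \<tau>. ?Q \<tau> j) \<and> \<not> (fst a = t \<and> is_ret (snd a))"
    by (auto simp: nth_append less_Suc_eq)
  finally show ?case using snoc by (cases "snd a") (auto simp: upd_busy_eq)
qed simp

text \<open>Induction from the right works because the status of an action as a library action
  depends only on the actions before it.\<close>

lemma client_eq_part: "client \<tau> = part False (\<lambda>_. False) \<tau>"
proof (induction \<tau> rule: rev_induct)
  case Nil
  then show ?case by (simp add: client_def)
next
  case (snoc a \<tau>)
  have 1: "library_action (\<tau> @ [a]) i = library_action \<tau> i" if "i < length \<tau>" for i
    using that by (auto simp: library_action_def nth_append)
  have 2: "library_action (\<tau> @ [a]) (length \<tau>) \<longleftrightarrow> is_exec (snd a) \<and> busy (\<lambda>_. False) \<tau> (fst a)"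
    unfolding library_action_def busy_iff_nth
    by (auto simp: nth_append)
  have "client (\<tau> @ [a]) = nths \<tau> {i. \<not> library_action (\<tau> @ [a]) i} @
      (if library_action (\<tau> @ [a]) (length \<tau>) then [] else [a])"
    by (simp add: client_def nths_append)
  also have "nths \<tau> {i. \<not> library_action (\<tau> @ [a]) i} = client \<tau>"
    unfolding client_def nths_def using 1
    by (intro arg_cong[where f="map fst"] filter_cong) (auto simp: set_zip)
  finally show ?case using snoc 2 by auto
qed

section \<open>Membership in trace sets\<close>

lemma alternating_append:
  "alternating us \<Longrightarrow> even (length us) \<Longrightarrow> alternating (us @ vs) = alternating vs"
  by (induction us rule: alternating.induct) auto

lemma alternating_ret:
  "alternating (us @ a # vs) \<Longrightarrow> is_ret a \<Longrightarrow> us \<noteq> [] \<and> is_call (last us)"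
proof (induction us rule: alternating.induct)
  case (3 m x m' y as)
  then show ?case by (cases as) auto
qed (auto elim: alternating.elims)

lemma alternating_prefix: "alternating (us @ vs) \<Longrightarrow> alternating us"
  by (induction us rule: alternating.induct) (auto elim: alternating.elims)

lemma is_trace_prefix: "is_trace (\<tau> @ \<tau>') \<Longrightarrow> is_trace \<tau>"
  unfolding is_trace_def by (auto dest: alternating_prefix)

text \<open>For an alternating history, even length means that no call is pending. This makes the
  notion closed under concatenation.\<close>

definition complete_thread :: "thread \<Rightarrow> ('c, 'm, 's) trace \<Rightarrow> bool" where
  "complete_thread t w \<longleftrightarrow> (\<forall>a\<in>set w. fst a = t \<and> erase (snd a) = snd a) \<and>
     alternating (map snd (history w)) \<and> even (length (history w))"

lemma complete_thread_append:
  "complete_thread t v \<Longrightarrow> complete_thread t w \<Longrightarrow> complete_thread t (v @ w)"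
  by (auto simp: complete_thread_def alternating_append)

lemma complete_thread_concat:
  "(\<And>w. w \<in> set ws \<Longrightarrow> complete_thread t w) \<Longrightarrow> complete_thread t (concat ws)"
  by (induction ws) (auto simp: complete_thread_append, simp add: complete_thread_def)

lemma complete_thread_kleene:
  "(\<And>w. w \<in> A \<Longrightarrow> complete_thread t w) \<Longrightarrow> w \<in> kleene A \<Longrightarrow> complete_thread t w"
  unfolding kleene_def by (auto intro!: complete_thread_concat)

definition exec_only :: "thread \<Rightarrow> ('c, 'm, 's) trace \<Rightarrow> bool" where
  "exec_only t w \<longleftrightarrow> (\<forall>a\<in>set w. fst a = t \<and> is_exec (snd a))"

lemma exec_only_history: "exec_only t w \<Longrightarrow> history w = []"
  by (induction w) (auto simp: exec_only_def not_interface_iff_exec[symmetric])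

lemma is_exec_erase: "is_exec a \<Longrightarrow> erase a = a"
  by (cases a) auto

lemma call_free_exec_only: "call_free C \<Longrightarrow> w \<in> com_traces \<eta> t C \<Longrightarrow> exec_only t w"
proof (induction C arbitrary: w)
  case (Iter C)
  then show ?case by (fastforce simp: exec_only_def kleene_def)
qed (fastforce simp: exec_only_def conc_def)+

lemma lib_env_exec_only: "is_library L \<Longrightarrow> w \<in> lib_env L m t \<Longrightarrow> exec_only t w"
  by (auto simp: lib_env_def is_library_def intro: call_free_exec_only ranI split: option.splits)

lemma com_traces_complete_thread:
  assumes "\<And>m w. w \<in> \<eta> m t \<Longrightarrow> exec_only t w"
  shows "w \<in> com_traces \<eta> t C \<Longrightarrow> complete_thread t w"
proof (induction C arbitrary: w)
  case (Prim c)
  then show ?case by (simp add: complete_thread_def)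
next
  case (Invoke m)
  then obtain u where "w = (t, Call m None) # u @ [(t, Ret m None)]" "u \<in> \<eta> m t" by auto
  then show ?case using assms[of u m] exec_only_history[of t u]
    by (auto simp: complete_thread_def exec_only_def is_exec_erase)
next
  case (Seq C D)
  then show ?case by (auto simp: conc_def complete_thread_append)
next
  case (Choice C D)
  then show ?case by auto
next
  case (Iter C)
  then show ?case by (auto intro: complete_thread_kleene)
qed

section \<open>Interleavings of complete threads\<close>

lemma proj_concat_rest:
  assumes "\<And>t. t \<in> set ts \<Longrightarrow> \<forall>a\<in>set (r t). fst a = t" "distinct ts"
  shows "proj u (concat (map r ts)) = (if u \<in> set ts then r u else [])"
  using assms
proof (induction ts)
  case (Cons t ts)
  have "proj u (r t) = (if u = t then r t else [])"
    using Cons.prems(1)[of t] unfolding proj_def by (auto intro: filter_True filter_False)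
  then show ?case using Cons by auto
qed simp

text \<open>An interleaved prefix is completed by running the missing suffixes of the threads one
  after the other. The result alternates because each complete thread does, so membership reduces to
  a condition on each thread alone.\<close>

lemma prefix_closure_par_traces:
  assumes T: "\<And>t w. t \<in> {1..n} \<Longrightarrow> w \<in> T t \<Longrightarrow> complete_thread t w"
  shows "\<tau> \<in> prefix_closure (par_traces n T) \<longleftrightarrow>
    (\<forall>a\<in>set \<tau>. fst a \<in> {1..n}) \<and> (\<forall>t\<in>{1..n}. \<exists>w\<in>T t. prefix (proj t \<tau>) w)"
    (is "?L \<longleftrightarrow> ?R")
proof
  assume ?L
  then obtain \<tau>' where "\<tau> @ \<tau>' \<in> par_traces n T"
    by (auto simp: prefix_closure_def prefix_def)
  then have "\<forall>a\<in>set \<tau>. fst a \<in> {1..n}" "\<forall>t\<in>{1..n}. proj t \<tau> @ proj t \<tau>' \<in> T t"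
    by (auto simp: par_traces_def)
  then show ?R using prefixI by blast
next
  assume R: ?R
  then have "\<forall>t\<in>{1..n}. \<exists>r. proj t \<tau> @ r \<in> T t" by (auto simp: prefix_def)
  then obtain r where r: "\<And>t. t \<in> {1..n} \<Longrightarrow> proj t \<tau> @ r t \<in> T t" by metis
  let ?\<tau> = "\<tau> @ concat (map r [1..<Suc n])"
  have rt: "\<forall>a\<in>set (r t). fst a = t" if "t \<in> {1..n}" for t
    using T[OF that r[OF that]] by (auto simp: complete_thread_def)
  have pr: "proj t ?\<tau> = (if t \<in> {1..n} then proj t \<tau> @ r t else [])" for t
  proof -
    have "proj t \<tau> = []" if "t \<notin> {1..n}"
      using R that by (auto simp: proj_def filter_empty_conv)
    moreover have "proj t (concat (map r [1..<Suc n])) = (if t \<in> {1..n} then r t else [])"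
      using proj_concat_rest[of "[1..<Suc n]" r t, OF _ distinct_upt] rt
      unfolding set_upt atLeastLessThanSuc_atLeastAtMost by blast
    ultimately show ?thesis by (simp split: if_splits)
  qed
  have "is_trace ?\<tau>"
    unfolding is_trace_def proj_history pr
    using T r by (auto simp: complete_thread_def simp del: history_simps(3))
  moreover have "\<forall>a\<in>set ?\<tau>. fst a \<in> {1..n}" using R rt by fastforce
  ultimately have "?\<tau> \<in> par_traces n T"
    unfolding par_traces_def using pr r by auto
  then show ?L unfolding prefix_closure_def by (auto intro!: bexI[where x="?\<tau>"])
qed

lemma com_traces_complete_thread_lib:
  "is_library L \<Longrightarrow> w \<in> com_traces (lib_env L) t C \<Longrightarrow> complete_thread t w"
  using com_traces_complete_thread lib_env_exec_only by metis

lemma com_traces_complete_thread_client: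
  "w \<in> com_traces (\<lambda>_ _. {[]}) t C \<Longrightarrow> complete_thread t w"
  using com_traces_complete_thread[of "\<lambda>_ _. {[]}" t w C] by (simp add: exec_only_def)

lemma kleene_Nil: "[] \<in> kleene A"
  unfolding kleene_def by (force intro: exI[where x="[]"])

lemma kleene_append: "u \<in> kleene A \<Longrightarrow> v \<in> kleene A \<Longrightarrow> u @ v \<in> kleene A"
  unfolding kleene_def by clarsimp (metis Un_subset_iff concat_append set_append)

lemma kleene_single: "u \<in> A \<Longrightarrow> u \<in> kleene A"
  unfolding kleene_def by (force intro: exI[where x="[u]"])

lemma busy_exec_only: "exec_only t w \<Longrightarrow> busy B w = B"
proof (induction w arbitrary: B)
  case (Cons a w)
  then have "upd_busy B a = B" by (cases a; cases "snd a") (auto simp: exec_only_def)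
  then show ?case using Cons by (auto simp: exec_only_def)
qed simp

lemma part_exec_only: "exec_only t w \<Longrightarrow> part k B w = (if B t = k then w else [])"
proof (induction w arbitrary: B)
  case (Cons a w)
  then have "upd_busy B a = B" by (cases a; cases "snd a") (auto simp: exec_only_def)
  then show ?case using Cons by (auto simp: exec_only_def)
qed simp

text \<open>The client side sees methods with empty bodies, the library side a sequence of method
  executions. The last conjunct lets the next command of a sequence or iteration start outside a
  method again.\<close>

lemma part_com_traces:
  assumes "is_library L"
  shows "w \<in> com_traces (lib_env L) t C \<Longrightarrow> \<not> B t \<Longrightarrow>
    part False B w \<in> com_traces (\<lambda>_ _. {[]}) t C \<and>
    part True B w \<in> kleene (\<Union>m\<in>dom L. com_traces (lib_env L) t (Invoke m)) \<and>
    \<not> busy B w t"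
proof (induction C arbitrary: w B)
  case (Prim c)
  then show ?case by (simp add: kleene_Nil)
next
  case (Invoke m)
  then obtain u where w: "w = (t, Call m None) # u @ [(t, Ret m None)]" and u: "u \<in> lib_env L m t"
    by auto
  have eo: "exec_only t u" using lib_env_exec_only[OF assms u] .
  have "m \<in> dom L" using u by (auto simp: lib_env_def split: option.splits)
  then have "w \<in> (\<Union>m\<in>dom L. com_traces (lib_env L) t (Invoke m))" using Invoke.prems by blast
  moreover have "part True B w = w" "part False B w = [(t, Call m None), (t, Ret m None)]"
    "\<not> busy B w t"
    using w eo by (simp_all add: part_exec_only busy_exec_only)
  ultimately show ?case by (auto intro: kleene_single)
next
  case (Seq C D)
  then obtain u v where w: "w = u @ v" "u \<in> com_traces (lib_env L) t C"
    "v \<in> com_traces (lib_env L) t D" by (auto simp: conc_def)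
  show ?case
    using Seq.IH(1)[of u B] Seq.IH(2)[of v "busy B u"] w Seq.prems(2)
    by (auto simp: conc_def intro: kleene_append)
next
  case (Choice C D)
  then show ?case by auto
next
  case (Iter C)
  then obtain ws where ws: "w = concat ws" "set ws \<subseteq> com_traces (lib_env L) t C"
    by (auto simp: kleene_def)
  \<comment> \<open>The busy map is arbitrary, since each round starts from the map that the
    previous round left behind.\<close>
  have "set ws \<subseteq> com_traces (lib_env L) t C \<Longrightarrow> \<not> B t \<Longrightarrow>
    part False B (concat ws) \<in> com_traces (\<lambda>_ _. {[]}) t (Iter C) \<and>
    part True B (concat ws) \<in> kleene (\<Union>m\<in>dom L. com_traces (lib_env L) t (Invoke m)) \<and>
    \<not> busy B (concat ws) t" for B
  proof (induction ws arbitrary: B)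
    case Nil
    then show ?case by (simp add: kleene_Nil)
  next
    case (Cons w ws)
    have "w \<in> com_traces (lib_env L) t C" using Cons.prems by simp
    note * = Iter.IH[of w B, OF this Cons.prems(2)]
    show ?case
      using * Cons.IH[of "busy B w"] Cons.prems(1)
      by (auto intro: kleene_append kleene_single)
  qed
  then show ?case using ws Iter.prems by blast
qed

section \<open>Trace sets of programs, described thread by thread\<close>

lemma traces_ClientLocal_iff:
  "\<tau> \<in> traces (ClientLocal \<Gamma> Cs) \<longleftrightarrow> (\<forall>a\<in>set \<tau>. fst a \<in> {1..length Cs}) \<and>
    (\<forall>t\<in>{1..length Cs}. \<exists>w\<in>com_traces (\<lambda>_ _. {[]}) t (Cs ! (t - 1)). prefix (proj t \<tau>) w)"
  unfolding traces.simps client_traces_def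
  by (rule prefix_closure_par_traces) (rule com_traces_complete_thread_client)

lemma traces_Complete_iff:
  "is_library L \<Longrightarrow> \<tau> \<in> traces (Complete Cs L) \<longleftrightarrow> (\<forall>a\<in>set \<tau>. fst a \<in> {1..length Cs}) \<and>
    (\<forall>t\<in>{1..length Cs}. \<exists>w\<in>com_traces (lib_env L) t (Cs ! (t - 1)). prefix (proj t \<tau>) w)"
  unfolding traces.simps client_traces_def
  by (rule prefix_closure_par_traces) (rule com_traces_complete_thread_lib)

lemma traces_LibLocalI:
  fixes L :: "('c, 'm) library" and \<tau> :: "('c, 'm, 's) trace"
  assumes L: "is_library L" and "\<forall>a\<in>set \<tau>. fst a \<in> {1..n}"
    and "\<forall>t\<in>{1..n}. \<exists>w\<in>kleene (\<Union>m\<in>dom L. com_traces (lib_env L) t (Invoke m)). prefix (proj t \<tau>) w"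
  shows "\<tau> \<in> traces (LibLocal L \<Gamma>)"
proof -
  let ?T = "\<lambda>t. kleene (\<Union>m\<in>dom L. com_traces (lib_env L) t (Invoke m) :: ('c, 'm, 's) trace set)"
  \<comment> \<open>One idle thread is added: the trace set of a library has at least one thread,
    while \<open>n\<close> may be 0.\<close>
  have "\<tau> \<in> prefix_closure (par_traces (Suc n) ?T)"
  proof (subst prefix_closure_par_traces)
    show "complete_thread t w" if "w \<in> ?T t" for t w
      using that com_traces_complete_thread_lib[OF L]
      by (elim complete_thread_kleene[rotated]) blast
    have "proj (Suc n) \<tau> = []" using assms(2) by (auto simp: proj_def filter_empty_conv)
    then show "(\<forall>a\<in>set \<tau>. fst a \<in> {1..Suc n}) \<and> (\<forall>t\<in>{1..Suc n}. \<exists>w\<in>?T t. prefix (proj t \<tau>) w)"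
      using assms(2,3) kleene_Nil by (fastforce simp: le_Suc_eq)
  qed
  then show ?thesis unfolding traces.simps prefix_closure_def by fastforce
qed

lemma part_traces:
  assumes L: "is_library L" and \<tau>: "\<tau> \<in> traces (Complete Cs L)"
  shows part_False_traces: "part False (\<lambda>_. False) \<tau> \<in> traces (ClientLocal \<Gamma> Cs)"
    and part_True_traces: "part True (\<lambda>_. False) \<tau> \<in> traces (LibLocal L \<Gamma>)"
proof -
  have *: "\<exists>w\<in>com_traces (\<lambda>_ _. {[]}) t (Cs ! (t - 1)). prefix (proj t (part False (\<lambda>_. False) \<tau>)) w"
     "\<exists>w\<in>kleene (\<Union>m\<in>dom L. com_traces (lib_env L) t (Invoke m)). prefix (proj t (part True (\<lambda>_. False) \<tau>)) w"
    if t: "t \<in> {1..length Cs}" for t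
  proof -
    obtain w where w: "w \<in> com_traces (lib_env L) t (Cs ! (t - 1))" "prefix (proj t \<tau>) w"
      using \<tau> t unfolding traces_Complete_iff[OF L] by blast
    have pp: "proj t (part k (\<lambda>_. False) \<tau>) = part k (\<lambda>_. False) (proj t \<tau>)" for k
      by (rule proj_part) simp
    show "\<exists>w\<in>com_traces (\<lambda>_ _. {[]}) t (Cs ! (t - 1)). prefix (proj t (part False (\<lambda>_. False) \<tau>)) w"
      "\<exists>w\<in>kleene (\<Union>m\<in>dom L. com_traces (lib_env L) t (Invoke m)). prefix (proj t (part True (\<lambda>_. False) \<tau>)) w"
      unfolding pp using part_com_traces[OF L w(1), of "\<lambda>_. False"] part_prefix[OF w(2)] by blast+
  qed
  have set: "\<forall>a\<in>set (part k (\<lambda>_. False) \<tau>). fst a \<in> {1..length Cs}" for k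
    using \<tau> set_part unfolding traces_Complete_iff[OF L] by blast
  show "part False (\<lambda>_. False) \<tau> \<in> traces (ClientLocal \<Gamma> Cs)"
    unfolding traces_ClientLocal_iff using * set by blast
  show "part True (\<lambda>_. False) \<tau> \<in> traces (LibLocal L \<Gamma>)"
    using traces_LibLocalI[OF L set] * by blast
qed

text \<open>Trace sets are built from ground actions; together with \<open>runs_Complete\<close>
  this makes every run of the complete program return the evaluated trace itself.\<close>

lemma traces_Complete_ground:
  assumes L: "is_library L" and \<tau>: "\<tau> \<in> traces (Complete Cs L)"
  shows "ground \<tau> = \<tau>"
proof -
  have "erase (snd a) = snd a" if "a \<in> set \<tau>" for a
  proof -
    have t: "fst a \<in> {1..length Cs}" using that \<tau> unfolding traces_Complete_iff[OF L] by blast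
    then obtain w where w: "w \<in> com_traces (lib_env L) (fst a) (Cs ! (fst a - 1))" "prefix (proj (fst a) \<tau>) w"
      using \<tau> unfolding traces_Complete_iff[OF L] by blast
    have "a \<in> set (proj (fst a) \<tau>)" using that by (simp add: proj_def)
    then have "a \<in> set w" using w(2) set_mono_prefix by blast
    then show ?thesis using com_traces_complete_thread_lib[OF L w(1)] by (simp add: complete_thread_def)
  qed
  then show ?thesis by (simp add: ground_eq_iff)
qed

lemma traces_ClientLocal_is_trace: "\<tau> \<in> traces (ClientLocal \<Gamma> Cs) \<Longrightarrow> is_trace \<tau>"
  by (auto simp: prefix_closure_def client_traces_def par_traces_def prefix_def dest: is_trace_prefix)

text \<open>The thread-wise description mentions the order of actions only within threads, so
  rearranged client traces stay in the trace set.\<close>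

lemma traces_ClientLocal_proj:
  assumes "\<tau> \<in> traces (ClientLocal \<Gamma> Cs)" "\<And>t. proj t \<tau>' = proj t \<tau>"
  shows "\<tau>' \<in> traces (ClientLocal \<Gamma> Cs)"
proof -
  have "a \<in> set \<tau>" if "a \<in> set \<tau>'" for a
  proof -
    have "a \<in> set (proj (fst a) \<tau>')" using that by (simp add: proj_def)
    then show ?thesis unfolding assms(2) by (simp add: proj_def)
  qed
  then show ?thesis using assms unfolding traces_ClientLocal_iff by auto
qed

section \<open>Decomposition of complete runs\<close>

text \<open>\<open>b\<close> tells whether thread \<open>t\<close> is executing a method. A command
  acts on one half with the other half as frame, by strong locality. A call or return only regroups
  the product, moving the transferred state across; for an unspecified method nothing moves.\<close>

lemma decomposition_step:
  fixes f :: "('c, 's::footprint_sep_algebra) transformers"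
  assumes loc: "strongly_local f"
    and s: "sc \<odot> sl = Some s"
    and c: "\<not> (is_exec a \<and> b) \<Longrightarrow> eval_action f (ClientLocal \<Gamma> Cs) sc (t, a) \<noteq> None"
    and l: "\<not> (is_exec a \<and> \<not> b) \<Longrightarrow> eval_action f (LibLocal L \<Gamma>) sl (t, a) \<noteq> None"
  shows "\<exists>S. eval_action f (Complete Cs L) s (t, a) = Some S \<and> (\<forall>(s', a')\<in>S.
    (\<exists>sc' sl'. sc' \<odot> sl' = Some s' \<and>
      (case a of Exec c \<Rightarrow>
         (if b then sc' = sc \<and> (\<exists>S. eval_action f (LibLocal L \<Gamma>) sl (t, a) = Some S \<and> (sl', (t, a)) \<in> S)
          else sl' = sl \<and> (\<exists>S. eval_action f (ClientLocal \<Gamma> Cs) sc (t, a) = Some S \<and> (sc', (t, a)) \<in> S))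
       | _ \<Rightarrow> (\<exists>x Sc Sl. eval_action f (ClientLocal \<Gamma> Cs) sc (t, a) = Some Sc \<and> (sc', x) \<in> Sc \<and>
           eval_action f (LibLocal L \<Gamma>) sl (t, a) = Some Sl \<and> (sl', x) \<in> Sl \<and> is_interface (snd x)))))"
proof (cases a)
  case (Exec c)
  show ?thesis
  proof (cases b)
    case True
    then obtain S where S: "f t c sl = Some S" using l Exec by auto
    then have "f t c s = Some (sep_prod S {sc})"
      using loc s unfolding strongly_local_def by (metis sep_comm)
    then show ?thesis using Exec True S by (auto simp: sep_prod_def sep_comm)
  next
    case False
    then obtain S where S: "f t c sc = Some S" using c Exec by auto
    then have "f t c s = Some (sep_prod S {sl})"
      using loc s unfolding strongly_local_def by metis
    then show ?thesis using Exec False S by (auto simp: sep_prod_def)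
  qed
next
  case (Call m x)
  show ?thesis
  proof (cases "\<Gamma> m")
    case None
    then show ?thesis using Call s by auto
  next
    case (Some pq)
    obtain p q where G: "\<Gamma> m = Some (p, q)" using Some by (cases pq) auto
    \<comment> \<open>The client half does not fault, so it contains a precondition state
      \<open>sp\<close>; the library half is made to receive this very state, and the annotations
      agree.\<close>
    then obtain sp sc' where sp: "sp \<in> p t" "sp \<odot> sc' = Some sc"
      using c Call by (auto simp: give_def splits_def split: if_splits)
    obtain y where y: "sc' \<odot> sp = Some sc" "sp \<odot> sl = Some y" "sc' \<odot> y = Some s"
      using sep_assoc_right[of sc' sp sc sl s] sp s by (metis sep_comm)
    have "eval_action f (ClientLocal \<Gamma> Cs) sc (t, a) = Some {(s2, (t, Call m (Some s1))) | s1 s2. (s1, s2) \<in> splits sc (p t)}"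
      using Call G sp by (auto simp: give_def splits_def)
    moreover have "(sc', (t, Call m (Some sp))) \<in> {(s2, (t, Call m (Some s1))) | s1 s2. (s1, s2) \<in> splits sc (p t)}"
      using sp by (auto simp: splits_def)
    moreover have "eval_action f (LibLocal L \<Gamma>) sl (t, a) = Some {(s', (t, Call m (Some s1))) | s1 s'. s1 \<in> p t \<and> sl \<odot> s1 = Some s'}"
      using Call G by (simp add: receive_def)
    moreover have "(y, (t, Call m (Some sp))) \<in> {(s', (t, Call m (Some s1))) | s1 s'. s1 \<in> p t \<and> sl \<odot> s1 = Some s'}"
      using sp y by (auto simp: sep_comm)
    ultimately show ?thesis using Call y(3) by fastforce
  qed
next
  case (Ret m x)
  show ?thesis
  proof (cases "\<Gamma> m")
    case None
    then show ?thesis using Ret s by auto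
  next
    case (Some pq)
    obtain p q where G: "\<Gamma> m = Some (p, q)" using Some by (cases pq) auto
    \<comment> \<open>Dually, the library half supplies the returned state
      \<open>sq\<close>.\<close>
    then obtain sq sl' where sq: "sq \<in> q t" "sq \<odot> sl' = Some sl"
      using l Ret by (auto simp: give_def splits_def split: if_splits)
    obtain y where y: "sc \<odot> sq = Some y" "y \<odot> sl' = Some s"
      using sep_assoc_left sq s by metis
    have "eval_action f (LibLocal L \<Gamma>) sl (t, a) = Some {(s2, (t, Ret m (Some s1))) | s1 s2. (s1, s2) \<in> splits sl (q t)}"
      using Ret G sq by (auto simp: give_def splits_def)
    moreover have "(sl', (t, Ret m (Some sq))) \<in> {(s2, (t, Ret m (Some s1))) | s1 s2. (s1, s2) \<in> splits sl (q t)}"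
      using sq by (auto simp: splits_def)
    moreover have "eval_action f (ClientLocal \<Gamma> Cs) sc (t, a) = Some {(s', (t, Ret m (Some s1))) | s1 s'. s1 \<in> q t \<and> sc \<odot> s1 = Some s'}"
      using Ret G by (simp add: receive_def)
    moreover have "(y, (t, Ret m (Some sq))) \<in> {(s', (t, Ret m (Some s1))) | s1 s'. s1 \<in> q t \<and> sc \<odot> s1 = Some s'}"
      using sq y by auto
    ultimately show ?thesis using Ret y(2) by fastforce
  qed
qed

text \<open>Both parts of the trace lie in the trace sets of the two halves, so safety excludes a
  fault at the next action. Choosing the same transferred state on both sides keeps the histories
  equal.\<close>

lemma decomposition:
  fixes f :: "('c, 's::footprint_sep_algebra) transformers" and L :: "('c, 'm) library"
  assumes loc: "strongly_local f"
    and L: "is_library L"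
    and safe: "safe f (LibLocal L \<Gamma>) I1" "safe f (ClientLocal \<Gamma> Cs) I"
    and \<sigma>: "\<sigma>c \<in> I" "\<sigma>l \<in> I1" "\<sigma>c \<odot> \<sigma>l = Some \<sigma>"
  shows "\<tau> \<in> traces (Complete Cs L) \<Longrightarrow> eval_trace f (Complete Cs L) \<tau> \<sigma> \<noteq> None \<and>
    (\<forall>(s, \<tau>')\<in>runs f (Complete Cs L) \<tau> \<sigma>. \<exists>sc sl \<kappa> \<xi>. sc \<odot> sl = Some s \<and>
      (sc, \<kappa>) \<in> runs f (ClientLocal \<Gamma> Cs) (part False (\<lambda>_. False) \<tau>) \<sigma>c \<and>
      (sl, \<xi>) \<in> runs f (LibLocal L \<Gamma>) (part True (\<lambda>_. False) \<tau>) \<sigma>l \<and>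
      history \<kappa> = history \<xi>)"
proof (induction \<tau> rule: rev_induct)
  case Nil
  then show ?case using \<sigma> by simp
next
  case (snoc a \<tau>)
  let ?c = "part False (\<lambda>_. False)" and ?l = "part True (\<lambda>_. False)"
  let ?C = "ClientLocal \<Gamma> Cs" and ?L = "LibLocal L \<Gamma>" and ?P = "Complete Cs L"
  obtain t x where a: "a = (t, x)" by fastforce
  let ?b = "busy (\<lambda>_. False) \<tau> t"
  have \<tau>: "\<tau> \<in> traces ?P" using snoc.prems traces_prefix by (metis prefixI)
  note tr = part_False_traces[OF L snoc.prems, of \<Gamma>] part_True_traces[OF L snoc.prems, of \<Gamma>]
  have step: "\<exists>S. eval_action f ?P s a = Some S \<and>
     (\<forall>(s', a')\<in>S. \<exists>sc' sl' \<kappa>' \<xi>'. sc' \<odot> sl' = Some s' \<and>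
      (sc', \<kappa>') \<in> runs f ?C (?c (\<tau> @ [a])) \<sigma>c \<and> (sl', \<xi>') \<in> runs f ?L (?l (\<tau> @ [a])) \<sigma>l \<and>
      history \<kappa>' = history \<xi>')"
    if run: "(s, \<tau>') \<in> runs f ?P \<tau> \<sigma>" for s \<tau>'
  proof -
    obtain sc sl \<kappa> \<xi> where s: "sc \<odot> sl = Some s" and \<kappa>: "(sc, \<kappa>) \<in> runs f ?C (?c \<tau>) \<sigma>c"
      and \<xi>: "(sl, \<xi>) \<in> runs f ?L (?l \<tau>) \<sigma>l" and h: "history \<kappa> = history \<xi>"
      using snoc.IH[OF \<tau>] run by blast
    have "eval_action f ?C sc (t, x) \<noteq> None" if "\<not> (is_exec x \<and> ?b)"
      using safe_eval_action[OF safe(2) \<sigma>(1) _ \<kappa>, of "(t, x)"] tr(1) a that by simp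
    moreover have "eval_action f ?L sl (t, x) \<noteq> None" if "\<not> (is_exec x \<and> \<not> ?b)"
      using safe_eval_action[OF safe(1) \<sigma>(2) _ \<xi>, of "(t, x)"] tr(2) a that by (simp split: if_splits)
    ultimately obtain S where S: "eval_action f ?P s (t, x) = Some S" and
      S': "\<And>s' a'. (s', a') \<in> S \<Longrightarrow>  (\<exists>sc' sl'. sc' \<odot> sl' = Some s' \<and>
      (case x of Exec c \<Rightarrow>
         (if ?b then sc' = sc \<and> (\<exists>S. eval_action f ?L sl (t, x) = Some S \<and> (sl', (t, x)) \<in> S)
          else sl' = sl \<and> (\<exists>S. eval_action f ?C sc (t, x) = Some S \<and> (sc', (t, x)) \<in> S))
       | _ \<Rightarrow> (\<exists>y Sc Sl. eval_action f ?C sc (t, x) = Some Sc \<and> (sc', y) \<in> Sc \<and>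
           eval_action f ?L sl (t, x) = Some Sl \<and> (sl', y) \<in> Sl \<and> is_interface (snd y))))"
      using decomposition_step[OF loc s, of x ?b \<Gamma> Cs t L] by blast
    have "\<exists>sc' sl' \<kappa>' \<xi>'. sc' \<odot> sl' = Some s' \<and>
      (sc', \<kappa>') \<in> runs f ?C (?c (\<tau> @ [a])) \<sigma>c \<and> (sl', \<xi>') \<in> runs f ?L (?l (\<tau> @ [a])) \<sigma>l \<and>
      history \<kappa>' = history \<xi>'" if "(s', a') \<in> S" for s' a'
    proof -
      obtain sc' sl' where s': "sc' \<odot> sl' = Some s'" and
        cs: "case x of Exec c \<Rightarrow>
         (if ?b then sc' = sc \<and> (\<exists>S. eval_action f ?L sl (t, x) = Some S \<and> (sl', (t, x)) \<in> S)
          else sl' = sl \<and> (\<exists>S. eval_action f ?C sc (t, x) = Some S \<and> (sc', (t, x)) \<in> S))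
       | _ \<Rightarrow> (\<exists>y Sc Sl. eval_action f ?C sc (t, x) = Some Sc \<and> (sc', y) \<in> Sc \<and>
           eval_action f ?L sl (t, x) = Some Sl \<and> (sl', y) \<in> Sl \<and> is_interface (snd y))"
        using S'[OF \<open>(s', a') \<in> S\<close>] by blast
      consider (lib) "is_exec x" "?b" | (cl) "is_exec x" "\<not> ?b" | (int) "\<not> is_exec x" by blast
      then show ?thesis
      proof cases
        case lib
        then obtain S where "sc' = sc" "eval_action f ?L sl (t, x) = Some S" "(sl', (t, x)) \<in> S"
          using cs by (cases x) auto
        moreover from this have "(sl', \<xi> @ [a]) \<in> runs f ?L (?l (\<tau> @ [a])) \<sigma>l"
          using lib \<xi> a by (auto simp: runs_snoc)
        moreover have "history (\<xi> @ [a]) = history \<kappa>" using lib h a not_interface_iff_exec by auto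
        ultimately show ?thesis using lib \<kappa> s' a by fastforce
      next
        case cl
        then obtain S where "sl' = sl" "eval_action f ?C sc (t, x) = Some S" "(sc', (t, x)) \<in> S"
          using cs by (cases x) auto
        moreover from this have "(sc', \<kappa> @ [a]) \<in> runs f ?C (?c (\<tau> @ [a])) \<sigma>c"
          using cl \<kappa> a by (auto simp: runs_snoc)
        moreover have "history (\<kappa> @ [a]) = history \<xi>" using cl h a not_interface_iff_exec by auto
        ultimately show ?thesis using cl \<xi> s' a by fastforce
      next
        case int
        then obtain y Sc Sl where y: "eval_action f ?C sc (t, x) = Some Sc" "(sc', y) \<in> Sc"
          "eval_action f ?L sl (t, x) = Some Sl" "(sl', y) \<in> Sl"
          using cs by (cases x) auto
        have "(sc', \<kappa> @ [y]) \<in> runs f ?C (?c (\<tau> @ [a])) \<sigma>c"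
          "(sl', \<xi> @ [y]) \<in> runs f ?L (?l (\<tau> @ [a])) \<sigma>l"
          using int y \<kappa> \<xi> a by (cases y; force simp: runs_snoc)+
        moreover have "history (\<kappa> @ [y]) = history (\<xi> @ [y])" using h by simp
        ultimately show ?thesis using s' by blast
      qed
    qed
    then show ?thesis using S a by blast
  qed
  have "eval_trace f ?P (\<tau> @ [a]) \<sigma> \<noteq> None"
    using snoc.IH[OF \<tau>] step unfolding eval_trace_snoc_None by fastforce
  moreover have "\<forall>(s', \<tau>')\<in>runs f ?P (\<tau> @ [a]) \<sigma>. \<exists>sc' sl' \<kappa>' \<xi>'. sc' \<odot> sl' = Some s' \<and>
      (sc', \<kappa>') \<in> runs f ?C (?c (\<tau> @ [a])) \<sigma>c \<and> (sl', \<xi>') \<in> runs f ?L (?l (\<tau> @ [a])) \<sigma>l \<and>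
      history \<kappa>' = history \<xi>'"
  proof safe
    fix s' \<tau>''
    assume "(s', \<tau>'') \<in> runs f ?P (\<tau> @ [a]) \<sigma>"
    then obtain s \<tau>' a' S where "(s, \<tau>') \<in> runs f ?P \<tau> \<sigma>" "eval_action f ?P s a = Some S"
      "(s', a') \<in> S" unfolding runs_snoc by blast
    then show "\<exists>sc' sl' \<kappa>' \<xi>'. sc' \<odot> sl' = Some s' \<and>
      (sc', \<kappa>') \<in> runs f ?C (?c (\<tau> @ [a])) \<sigma>c \<and> (sl', \<xi>') \<in> runs f ?L (?l (\<tau> @ [a])) \<sigma>l \<and>
      history \<kappa>' = history \<xi>'"
      using step by fastforce
  qed
  ultimately show ?case by blast
qed

section \<open>Rearrangement of client runs\<close>

text \<open>Each command is paired with the number of interface actions before it. This records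
  where commands stand without fixing the interface actions, in which a partial rearrangement may
  differ from the original.\<close>

primrec marks :: "nat \<Rightarrow> ('c, 'm, 's) trace \<Rightarrow> (nat \<times> ('c, 'm, 's) action) list" where
  "marks n [] = []"
| "marks n (a # \<tau>) =
     (if is_interface (snd a) then marks (Suc n) \<tau> else (n, a) # marks n \<tau>)"

lemma marks_append: "marks n (\<tau> @ \<tau>') = marks n \<tau> @ marks (n + length (history \<tau>)) \<tau>'"
  by (induction \<tau> arbitrary: n) auto

lemma marks_ge: "(i, a) \<in> set (marks n \<tau>) \<Longrightarrow> n \<le> i"
  by (induction \<tau> arbitrary: n) (auto split: if_splits dest: Suc_leD)

text \<open>Marks and history together determine how commands and interface actions
  interleave.\<close>

lemma marks_history_inj:
  "marks n xs = marks n ys \<Longrightarrow> history xs = history ys \<Longrightarrow> xs = ys"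
proof (induction xs arbitrary: n ys)
  case Nil
  then show ?case by (cases ys) (auto split: if_splits)
next
  case (Cons x xs)
  show ?case
  proof (cases ys)
    case Nil
    then show ?thesis using Cons.prems by (auto split: if_splits)
  next
    case (Cons y ys')
    \<comment> \<open>After an interface action all marks exceed \<open>n\<close>, so both traces
      must begin with the same kind of action.\<close>
    have ne: "marks (Suc n) zs \<noteq> (n, a) # r" for a r and zs :: "('a, 'b, 'c) trace"
      using marks_ge[of n a "Suc n" zs] by auto
    have "is_interface (snd x) \<longleftrightarrow> is_interface (snd y)"
      using Cons.prems(1) Cons ne ne[symmetric] by (auto split: if_splits)
    then show ?thesis using Cons.prems Cons.IH Cons by (auto split: if_splits)
  qed
qed

lemma filter_eq_map_nth: "filter P xs = map (nth xs) (filter (\<lambda>i. P (xs ! i)) [0..<length xs])"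
proof -
  have "filter P xs = filter P (map (nth xs) [0..<length xs])" by (simp add: map_nth)
  then show ?thesis by (simp add: filter_map comp_def)
qed

section \<open>Single client-local steps and the states they transfer\<close>

fun payload :: "('c, 'm, 's) act \<Rightarrow> 's" where
  "payload (Call m (Some s)) = s"
| "payload (Ret m (Some s)) = s"

text \<open>The condition for performing an interface action that does not refer to the current
  state. It therefore survives moving the action within a run.\<close>

fun transferable :: "('m, 's) method_spec \<Rightarrow> ('c, 'm, 's) action \<Rightarrow> bool" where
  "transferable \<Gamma> (t, Call m (Some s)) \<longleftrightarrow> (\<exists>p q. \<Gamma> m = Some (p, q) \<and> s \<in> p t)"
| "transferable \<Gamma> (t, Ret m (Some s)) \<longleftrightarrow> (\<exists>p q. \<Gamma> m = Some (p, q) \<and> s \<in> q t)"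
| "transferable \<Gamma> _ \<longleftrightarrow> False"

text \<open>Demanding \<open>a\<close> itself as the resulting action fixes the transferred
  state.\<close>

definition step :: "('c, 's::sep_algebra) transformers \<Rightarrow> ('c, 'm, 's) program \<Rightarrow> 's \<Rightarrow>
    ('c, 'm, 's) action \<Rightarrow> 's \<Rightarrow> bool" where
  "step f P s a s' \<longleftrightarrow> (\<exists>S. eval_action f P s a = Some S \<and> (s', a) \<in> S)"

lemma runs_self_snoc:
  "(s'', \<kappa> @ [a]) \<in> runs f P (\<kappa> @ [a]) s \<longleftrightarrow> (\<exists>s'. (s', \<kappa>) \<in> runs f P \<kappa> s \<and> step f P s' a s'')"
  unfolding runs_snoc step_def by (metis append1_eq_conv)

lemma step_exec:
  "step f P s (t, Exec c) s' \<longleftrightarrow> (\<exists>S. f t c s = Some S \<and> s' \<in> S)"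
  by (auto simp: step_def)

lemma step_call:
  assumes "is_call (snd a)" "annotated (snd a)"
  shows "step f (ClientLocal \<Gamma> Cs) s a s' \<longleftrightarrow>
    transferable \<Gamma> a \<and> payload (snd a) \<odot> s' = Some s"
proof -
  obtain t m x where "a = (t, Call m (Some x))"
    using assms by (cases a; cases "snd a") auto
  then show ?thesis
    by (cases "\<Gamma> m") (fastforce simp: step_def give_def splits_def split: option.splits if_splits)+
qed

lemma step_ret:
  assumes "is_ret (snd a)" "annotated (snd a)"
  shows "step f (ClientLocal \<Gamma> Cs) s a s' \<longleftrightarrow>
    transferable \<Gamma> a \<and> s \<odot> payload (snd a) = Some s'"
proof -
  obtain t m x where "a = (t, Ret m (Some x))"
    using assms by (cases a; cases "snd a") auto
  then show ?thesis
    by (cases "\<Gamma> m") (auto simp: step_def receive_def split: option.splits if_splits)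
qed

lemma fp_step_call:
  "is_call a \<Longrightarrow> annotated a \<Longrightarrow> fp_step l a = fp_comp l (fp (payload a))"
  by (cases a) auto

lemma fp_step_ret:
  "is_ret a \<Longrightarrow> annotated a \<Longrightarrow> fp_step l a = fp_minus l (fp (payload a))"
  by (cases a) auto

lemma fp_eval_snoc: "fp_eval (H @ [a]) l = Option.bind (fp_eval H l) (\<lambda>l'. fp_step l' (snd a))"
  by (simp add: fp_eval_def)

lemma fp_eval_prefix: "fp_eval (H @ H') l \<noteq> None \<Longrightarrow> fp_eval H l \<noteq> None"
proof (induction H' rule: rev_induct)
  case (snoc a H')
  then show ?case using fp_eval_snoc[of "H @ H'" a l] by (auto split: Option.bind_splits)
qed simp

lemma runs_transferable:
  "(s', \<kappa>) \<in> runs f (ClientLocal \<Gamma> Cs) \<kappa> s \<Longrightarrow> a \<in> set \<kappa> \<Longrightarrow> annotated (snd a) \<Longrightarrow> transferable \<Gamma> a"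
proof (induction \<kappa> arbitrary: s' rule: rev_induct)
  case (snoc b \<kappa>)
  then obtain u where u: "(u, \<kappa>) \<in> runs f (ClientLocal \<Gamma> Cs) \<kappa> s" "step f (ClientLocal \<Gamma> Cs) u b s'"
    unfolding runs_self_snoc by blast
  show ?case
  proof (cases "a = b")
    case True
    have "is_call (snd b) \<or> is_ret (snd b)" using snoc.prems(3) True by (cases "snd b") auto
    then show ?thesis using u(2) snoc.prems(3) True step_call step_ret by metis
  next
    case False
    then show ?thesis using snoc u by auto
  qed
qed simp

text \<open>The last interface action of an idle thread is a return, since a call would have left
  the thread busy.\<close>

lemma idle_ret:
  assumes "\<not> busy (\<lambda>_. False) \<tau> t" "k < length (history \<tau>)" "fst (history \<tau> ! k) = t"
  shows "\<exists>k'\<ge>k. k' < length (history \<tau>) \<and> fst (history \<tau> ! k') = t \<and> is_ret (snd (history \<tau> ! k'))"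
  using assms
proof (induction \<tau> rule: rev_induct)
  case (snoc a \<tau>)
  consider (ex) "is_exec (snd a)" | (other) "\<not> is_exec (snd a)" "fst a \<noteq> t"
    | (ret) "is_ret (snd a)" "fst a = t"
    using snoc.prems(1) by (cases "snd a") (auto simp: upd_busy_eq split: if_splits)
  then show ?case
  proof cases
    case ex
    then have "history (\<tau> @ [a]) = history \<tau>" using not_interface_iff_exec by auto
    then show ?thesis using snoc ex by (simp add: upd_busy_eq split: if_splits)
  next
    case other
    then have h: "history (\<tau> @ [a]) = history \<tau> @ [a]" by (auto simp: not_interface_iff_exec[symmetric])
    have k: "k < length (history \<tau>)" using snoc.prems(2,3) h other
      by (auto simp: nth_append less_Suc_eq split: if_splits)
    moreover have "\<not> busy (\<lambda>_. False) \<tau> t" using snoc.prems(1) other by (simp add: upd_busy_eq)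
    ultimately obtain k' where "k' \<ge> k" "k' < length (history \<tau>)" "fst (history \<tau> ! k') = t"
      "is_ret (snd (history \<tau> ! k'))"
      using snoc.IH snoc.prems(3) h by (auto simp: nth_append)
    then show ?thesis unfolding h by (intro exI[of _ k']) (auto simp: nth_append)
  next
    case ret
    then have h: "history (\<tau> @ [a]) = history \<tau> @ [a]" by auto
    show ?thesis unfolding h using ret snoc.prems(2)
      by (intro exI[of _ "length (history \<tau>)"]) (auto simp: h)
  qed
qed simp

lemma proj_last_split:
  assumes "proj t zs \<noteq> []"
  obtains xs y ys where "zs = xs @ y # ys" "fst y = t" "proj t ys = []"
proof -
  have "\<exists>xs y ys. zs = xs @ y # ys \<and> fst y = t \<and> proj t ys = []"
    using assms
  proof (induction zs rule: rev_induct)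
    case (snoc z zs)
    show ?case
    proof (cases "fst z = t")
      case True
      then show ?thesis by (intro exI[of _ zs] exI[of _ z] exI[of _ "[]"]) auto
    next
      case False
      then obtain xs y ys where "zs = xs @ y # ys" "fst y = t" "proj t ys = []"
        using snoc by auto
      then show ?thesis using False
        by (intro exI[of _ xs] exI[of _ y] exI[of _ "ys @ [z]"]) auto
    qed
  qed simp
  then show thesis using that by blast
qed

text \<open>By alternation, the last action of the thread before a return is a call.\<close>

lemma trace_ret_call:
  assumes "is_trace H" "history H = H" "k < length H" "is_ret (snd (H ! k))"
  shows "\<exists>k'<k. fst (H ! k') = fst (H ! k) \<and> is_call (snd (H ! k')) \<and>
    (\<forall>i. k' < i \<and> i < k \<longrightarrow> fst (H ! i) \<noteq> fst (H ! k))"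
proof -
  let ?t = "fst (H ! k)"
  let ?us = "proj ?t (take k H)"
  have "H = take k H @ H ! k # drop (Suc k) H" using assms(3) by (rule id_take_nth_drop)
  then have "proj ?t H = ?us @ H ! k # proj ?t (drop (Suc k) H)"
    by (metis proj_simps(2,3))
  then have "alternating (map snd ?us @ snd (H ! k) # map snd (proj ?t (drop (Suc k) H)))"
    using assms(1,2) unfolding is_trace_def by (metis list.simps(9) map_append)
  then have "map snd ?us \<noteq> [] \<and> is_call (last (map snd ?us))"
    by (rule alternating_ret) (rule assms(4))
  then have us: "?us \<noteq> []" "is_call (snd (last ?us))" by (auto simp: last_map)
  obtain xs y ys where xy: "take k H = xs @ y # ys" "fst y = ?t" "proj ?t ys = []"
    using proj_last_split[OF us(1)] by blast
  have len: "length (xs @ y # ys) = k" using xy(1) assms(3) by (metis length_take min.absorb4)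
  have "is_call (snd y)" using us(2) xy(2,3) unfolding xy(1) by simp
  moreover have nth: "H ! i = (xs @ y # ys) ! i" if "i < k" for i
    using xy(1) that by (metis nth_take)
  moreover have "fst (H ! i) \<noteq> ?t" if "length xs < i" "i < k" for i
  proof -
    have "H ! i = ys ! (i - Suc (length xs))" using nth that by (simp add: nth_append nth_Cons')
    moreover have "i - Suc (length xs) < length ys" using len that by simp
    ultimately have "H ! i \<in> set ys" by simp
    then show ?thesis using xy(3) by (auto simp: proj_def filter_empty_conv)
  qed
  moreover have "length xs < k" using len by simp
  ultimately show ?thesis using xy(2) nth[of "length xs"]
    by (intro exI[of _ "length xs"]) auto
qed

text \<open>\<open>\<rho>\<close> is increasing on the positions of one thread, hence maps their
  sorted list in \<open>H\<close> to a sorted list in \<open>H'\<close>; sorted distinct lists with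
  the same elements are equal.\<close>

lemma history_le_proj:
  assumes bij: "bij_betw \<rho> {..<length H} {..<length H'}"
    and eq: "\<And>i. i < length H \<Longrightarrow> H ! i = H' ! \<rho> i"
    and mono: "\<And>i j. i < j \<Longrightarrow> j < length H \<Longrightarrow> fst (H ! i) = fst (H ! j) \<Longrightarrow> \<rho> i < \<rho> j"
  shows "proj t H = proj t H'"
proof -
  let ?I = "filter (\<lambda>i. fst (H ! i) = t) [0..<length H]"
  let ?I' = "filter (\<lambda>i. fst (H' ! i) = t) [0..<length H']"
  have "sorted_wrt (\<lambda>i j. \<rho> i < \<rho> j) ?I"
    by (rule sorted_wrt_mono_rel[of _ "(<)"]) (use mono in \<open>auto intro: sorted_wrt_filter\<close>)
  then have "sorted_wrt (<) (map \<rho> ?I)" by (simp add: sorted_wrt_map)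
  then have s: "sorted (map \<rho> ?I)" "distinct (map \<rho> ?I)"
    by (simp_all add: strict_sorted_iff)
  have img: "\<rho> ` {..<length H} = {..<length H'}" using bij by (simp add: bij_betw_def)
  have "set (map \<rho> ?I) = set ?I'"
  proof -
    have "set (map \<rho> ?I) = \<rho> ` {i \<in> {..<length H}. fst (H' ! \<rho> i) = t}" using eq by auto
    also have "\<dots> = {i \<in> \<rho> ` {..<length H}. fst (H' ! i) = t}" by blast
    finally show ?thesis unfolding img by auto
  qed
  then have "map \<rho> ?I = ?I'"
    using sorted_distinct_set_unique[OF s, of ?I'] by (simp add: sorted_wrt_filter)
  then have "map (nth H') ?I' = map (nth H') (map \<rho> ?I)" by simp
  also have "\<dots> = map (nth H) ?I" using eq by simp
  finally have "map (nth H') ?I' = map (nth H) ?I" .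
  then show ?thesis unfolding proj_def filter_eq_map_nth[of _ H] filter_eq_map_nth[of _ H'] by simp
qed

text \<open>The run of \<open>\<kappa>\<close> leads from \<open>s0\<close> to \<open>s1\<close>.
  \<open>idle\<close> expresses that the client executes commands only outside methods, and
  \<open>comp\<close> that \<open>s0\<close> is compatible with the footprint from which
  \<open>H'\<close> is balanced.\<close>

locale rearrangement =
  fixes f :: "('c, 's::footprint_sep_algebra) transformers"
    and \<Gamma> :: "('m, 's) method_spec" and Cs :: "('c, 'm) client"
    and \<kappa> H H' :: "('c, 'm, 's) trace" and \<rho> :: "nat \<Rightarrow> nat" and s0 s1 L0 :: 's
  assumes fpp: "footprint_preserving f" and loc: "strongly_local f"
    and H_def: "H = history \<kappa>"
    and run: "(s1, \<kappa>) \<in> runs f (ClientLocal \<Gamma> Cs) \<kappa> s0"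
    and ann: "\<And>a. a \<in> set H \<Longrightarrow> annotated (snd a)"
    and trace: "is_trace \<kappa>"
    and idle: "\<And>\<kappa>0 t a \<kappa>1. \<kappa> = \<kappa>0 @ (t, a) # \<kappa>1 \<Longrightarrow> is_exec a \<Longrightarrow> \<not> busy (\<lambda>_. False) \<kappa>0 t"
    and bij: "bij_betw \<rho> {..<length H} {..<length H'}"
    and H'_nth: "\<And>i. i < length H \<Longrightarrow> H ! i = H' ! \<rho> i"
    and mono: "\<And>i j. i < j \<Longrightarrow> j < length H \<Longrightarrow>
      fst (H ! i) = fst (H ! j) \<or> is_ret (snd (H ! i)) \<and> is_call (snd (H ! j)) \<Longrightarrow> \<rho> i < \<rho> j"
    and bal: "balanced (fp L0) H'"
    and comp: "s0 \<odot> L0 \<noteq> None"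
begin

abbreviation "P \<equiv> ClientLocal \<Gamma> Cs"
abbreviation "pay k \<equiv> payload (snd (H ! k))"
abbreviation "emitted j \<equiv> {k. k < length H \<and> \<rho> k < j}"

text \<open>\<open>\<kappa>0\<close> is a prefix of \<open>\<kappa>\<close> leading to \<open>x\<close>, and \<open>\<kappa>'\<close> is a rearrangement of it which has performed
  the first \<open>j\<close> actions of \<open>H'\<close>.  It may be ahead in returns and behind in calls, so that its state
  \<open>y\<close> is \<open>x\<close> together with what is transferred by the actions that only one of the two has
  performed.  The footprint of the library that goes with \<open>y\<close> is that of \<open>L\<close>.\<close>

definition sim :: "('c, 'm, 's) trace \<Rightarrow> 's \<Rightarrow> nat \<Rightarrow> bool" where
  "sim \<kappa>0 x j \<longleftrightarrow> j \<le> length H' \<and>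
    (\<forall>k<length (history \<kappa>0). is_ret (snd (H ! k)) \<longrightarrow> k \<in> emitted j) \<and>
    (\<forall>k\<in>emitted j. is_call (snd (H ! k)) \<longrightarrow> k < length (history \<kappa>0)) \<and>
    (\<exists>\<kappa>' y z L. history \<kappa>' = take j H' \<and>
      filter (\<lambda>a. \<not> is_interface (snd a)) \<kappa>' = filter (\<lambda>a. \<not> is_interface (snd a)) \<kappa>0 \<and>
      (\<forall>t. marks 0 (proj t \<kappa>') = marks 0 (proj t \<kappa>0)) \<and>
      (y, \<kappa>') \<in> runs f P \<kappa>' s0 \<and> x \<odot> z = Some y \<and>
      sep_big pay (({..<length (history \<kappa>0)} - emitted j) \<union> (emitted j - {..<length (history \<kappa>0)})) z \<and>
      fp_eval (take j H') (fp L0) = Some (fp L) \<and> y \<odot> L \<noteq> None)"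

section \<open>Positions of \<open>H\<close> and the bijection \<open>\<rho>\<close>\<close>

lemma H_interface: "k < length H \<Longrightarrow> is_interface (snd (H ! k))"
  using nth_mem[of k H] unfolding H_def history_def by auto

lemma H_annotated: "k < length H \<Longrightarrow> annotated (snd (H ! k))"
  using ann nth_mem by blast

lemma H_transferable: "k < length H \<Longrightarrow> transferable \<Gamma> (H ! k)"
  using runs_transferable[OF run, of "H ! k"] H_annotated[of k] nth_mem[of k H]
  by (simp add: H_def history_def)

lemma \<rho>_eq_iff: "i < length H \<Longrightarrow> k < length H \<Longrightarrow> \<rho> i = \<rho> k \<longleftrightarrow> i = k"
  using bij unfolding bij_betw_def inj_on_def by auto

lemma \<rho>_less: "k < length H \<Longrightarrow> \<rho> k < length H'"
  using bij unfolding bij_betw_def by auto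

lemma \<rho>_surj: assumes "j < length H'" obtains k where "k < length H" "\<rho> k = j"
  using assms bij unfolding bij_betw_def by (metis imageE lessThan_iff)

lemma sim_init: "sim [] s0 0"
proof -
  have "(s0, []) \<in> runs f P [] s0" "s0 \<odot> sep_unit = Some s0"
    "sep_big pay ({..<0} - emitted 0 \<union> (emitted 0 - {..<0})) sep_unit"
    "fp_eval (take 0 H') (fp L0) = Some (fp L0)"
    by (simp_all add: sep_unit_right sep_big_empty fp_eval_def)
  then show ?thesis
    unfolding sim_def history_simps list.size using comp
    by (intro conjI exI[of _ "[]"] exI[of _ s0] exI[of _ sep_unit] exI[of _ L0]) simp_all
qed

lemma marks_proj_snoc_interface:
  "is_interface (snd a) \<Longrightarrow> marks 0 (proj t (\<tau> @ [a])) = marks 0 (proj t \<tau>)"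
  by (auto simp: marks_append)

text \<open>Emitting a call that \<open>\<kappa>0\<close> has passed takes its state out of
  \<open>z\<close> and hands it to the library. Emitting a return adds its state to
  \<open>z\<close>; balance of \<open>H'\<close> ensures that the library footprint can provide
  it.\<close>

lemma sim_emit:
  assumes sim: "sim \<kappa>0 x j" and k: "k < length H" "\<rho> k = j"
    and call: "is_call (snd (H ! k)) \<Longrightarrow> k < length (history \<kappa>0)"
  shows "sim \<kappa>0 x (Suc j)"
proof -
  let ?n = "length (history \<kappa>0)" and ?a = "H ! k"
  let ?D = "\<lambda>j. ({..<?n} - emitted j) \<union> (emitted j - {..<?n})"
  have j: "j < length H'" using \<rho>_less k by blast
  have a: "H' ! j = ?a" using H'_nth k by simp
  have tk: "take (Suc j) H' = take j H' @ [?a]" using a j by (simp add: take_Suc_conv_app_nth)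
  have em: "emitted (Suc j) = insert k (emitted j)" "k \<notin> emitted j"
    using k \<rho>_eq_iff by (auto simp: less_Suc_eq)
  from sim obtain \<kappa>' y z L where
    rets: "\<forall>k<?n. is_ret (snd (H ! k)) \<longrightarrow> k \<in> emitted j"
    and calls: "\<forall>k\<in>emitted j. is_call (snd (H ! k)) \<longrightarrow> k < ?n"
    and hist: "history \<kappa>' = take j H'"
    and ex: "filter (\<lambda>a. \<not> is_interface (snd a)) \<kappa>' = filter (\<lambda>a. \<not> is_interface (snd a)) \<kappa>0"
    and mk: "\<forall>t. marks 0 (proj t \<kappa>') = marks 0 (proj t \<kappa>0)"
    and ru: "(y, \<kappa>') \<in> runs f P \<kappa>' s0" and xz: "x \<odot> z = Some y"
    and big: "sep_big pay (?D j) z"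
    and fpL: "fp_eval (take j H') (fp L0) = Some (fp L)" and yL: "y \<odot> L \<noteq> None"
    unfolding sim_def by blast
  have int: "is_interface (snd ?a)" using H_interface k by blast
  have hist': "history (\<kappa>' @ [?a]) = take (Suc j) H'" using hist int tk by simp
  have ev: "fp_eval (take (Suc j) H') (fp L0) = fp_step (fp L) (snd ?a)"
    using fpL tk by (simp add: fp_eval_snoc)
  have "\<exists>y' z' L'. step f P y ?a y' \<and> x \<odot> z' = Some y' \<and> sep_big pay (?D (Suc j)) z' \<and>
     fp_step (fp L) (snd ?a) = Some (fp L') \<and> y' \<odot> L' \<noteq> None"
  proof (cases "is_call (snd ?a)")
    case True
    then have n: "k < ?n" using call by blast
    have D: "?D (Suc j) = ?D j - {k}" "k \<in> ?D j" using em n by auto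
    obtain z' where z': "sep_big pay (?D (Suc j)) z'" "pay k \<odot> z' = Some z"
      unfolding D(1) using sep_big_remove[OF big D(2)] by blast
    obtain y' where y': "x \<odot> z' = Some y'" "y' \<odot> pay k = Some y"
      using sep_assoc_left[of z' "pay k" z x y] z'(2) xz by (metis sep_comm)
    obtain w where w: "y \<odot> L = Some w" using yL by blast
    obtain L' where L': "pay k \<odot> L = Some L'" "y' \<odot> L' = Some w"
      using sep_assoc_right y'(2) w by blast
    have "fp_step (fp L) (snd ?a) = Some (fp L')"
      using fp_step_call[OF True H_annotated[OF k(1)]] fp_comp_fp L'(1) by (metis sep_comm)
    moreover have "step f P y ?a y'"
      using step_call[OF True H_annotated[OF k(1)]] H_transferable[OF k(1)] y'(2) by (metis sep_comm)
    ultimately show ?thesis using z'(1) y'(1) L'(2) by blast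
  next
    case False
    then have ret: "is_ret (snd ?a)" using int by blast
    \<comment> \<open>All returns passed by \<open>\<kappa>0\<close> have been emitted already, so
      this one lies ahead of \<open>\<kappa>0\<close>.\<close>
    then have n: "\<not> k < ?n" using rets em by blast
    have D: "?D (Suc j) = insert k (?D j)" "k \<notin> ?D j" using em n by auto
    have "fp_eval (take (Suc j) H') (fp L0) \<noteq> None"
      using bal fp_eval_prefix[of "take (Suc j) H'" "drop (Suc j) H'"] by (simp add: balanced_def)
    then have "fp_minus (fp L) (fp (pay k)) \<noteq> None"
      using ev fp_step_ret[OF ret H_annotated[OF k(1)]] by metis
    then obtain a b l where abl: "fp (pay k) = fp a" "fp L = fp l" "a \<odot> b = Some l"
      by (rule fp_minusE)
    have stp: "fp_step (fp L) (snd ?a) = Some (fp b)"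
      using fp_step_ret[OF ret H_annotated[OF k(1)]] fp_minus_fp[OF abl(3)] abl(1,2) by metis
    \<comment> \<open>Definedness depends only on footprints: \<open>L\<close> is replaced by
      \<open>l\<close>, which splits into \<open>a\<close> and \<open>b\<close>, and then
      \<open>a\<close> by the transferred state of the same footprint. The library keeps
      \<open>b\<close>.\<close>
    have "y \<odot> l \<noteq> None" using yL fp_eq_defined_right[OF abl(2)] by blast
    then obtain w where w: "y \<odot> l = Some w" by blast
    have "b \<odot> a = Some l" using abl(3) by (simp add: sep_comm)
    then obtain u where u: "y \<odot> b = Some u" "u \<odot> a = Some w"
      using sep_assoc_left w by blast
    then obtain w' where w': "u \<odot> pay k = Some w'"
      using fp_eq_defined_right[OF abl(1)] by blast
    have "b \<odot> y = Some u" using u(1) by (simp add: sep_comm)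
    then obtain y' where y': "y \<odot> pay k = Some y'" "b \<odot> y' = Some w'"
      using sep_assoc_right w' by blast
    obtain z' where z': "z \<odot> pay k = Some z'" "x \<odot> z' = Some y'"
      using sep_assoc_right xz y'(1) by blast
    have "pay k \<odot> z = Some z'" using z'(1) by (simp add: sep_comm)
    then have "sep_big pay (?D (Suc j)) z'"
      unfolding D(1) by (rule sep_big_insert[OF big D(2)])
    moreover have "step f P y ?a y'"
      using step_ret[OF ret H_annotated[OF k(1)]] H_transferable[OF k(1)] y'(1) by metis
    moreover have "y' \<odot> b \<noteq> None" using y'(2) by (simp add: sep_comm)
    ultimately show ?thesis using z'(2) stp by blast
  qed
  then obtain y' z' L' where new: "step f P y ?a y'" "x \<odot> z' = Some y'" "sep_big pay (?D (Suc j)) z'"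
    "fp_step (fp L) (snd ?a) = Some (fp L')" "y' \<odot> L' \<noteq> None" by blast
  have "(y', \<kappa>' @ [?a]) \<in> runs f P (\<kappa>' @ [?a]) s0" using runs_self_snoc ru new(1) by blast
  moreover have "filter (\<lambda>a. \<not> is_interface (snd a)) (\<kappa>' @ [?a]) = filter (\<lambda>a. \<not> is_interface (snd a)) \<kappa>0"
    using ex int by simp
  moreover have "\<forall>t. marks 0 (proj t (\<kappa>' @ [?a])) = marks 0 (proj t \<kappa>0)"
    using mk marks_proj_snoc_interface[OF int] by metis
  moreover have "\<forall>k<?n. is_ret (snd (H ! k)) \<longrightarrow> k \<in> emitted (Suc j)"
    using rets unfolding em(1) by blast
  moreover have "\<forall>k\<in>emitted (Suc j). is_call (snd (H ! k)) \<longrightarrow> k < ?n"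
    using calls call unfolding em(1) by blast
  moreover have "fp_eval (take (Suc j) H') (fp L0) = Some (fp L')" using ev new(4) by simp
  ultimately show ?thesis unfolding sim_def using hist' new(2,3,5) Suc_leI[OF j] by blast
qed

lemma sim_emit_upto:
  assumes "sim \<kappa>0 x j" "j \<le> j'" "j' \<le> length H'"
    and "\<And>k. k < length H \<Longrightarrow> j \<le> \<rho> k \<Longrightarrow> \<rho> k < j' \<Longrightarrow> is_call (snd (H ! k)) \<Longrightarrow> k < length (history \<kappa>0)"
  shows "sim \<kappa>0 x j'"
  using assms(2,1,3,4)
proof (induction rule: dec_induct)
  case (step i)
  obtain k where k: "k < length H" "\<rho> k = i" using \<rho>_surj[of i] step.prems(2) by auto
  have "sim \<kappa>0 x i" using step by auto
  then show ?case using sim_emit k step.prems(3) step.hyps(1) by blast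
qed simp

lemma H_nth_length:
  assumes "\<kappa> = \<kappa>0 @ a # \<kappa>1" "is_interface (snd a)"
  shows "length (history \<kappa>0) < length H" "H ! length (history \<kappa>0) = a"
  using assms unfolding H_def by auto

text \<open>Nothing is emitted: the call becomes pending, and its state moves from \<open>x\<close>
  to \<open>z\<close>.\<close>

lemma sim_call:
  assumes sim: "sim \<kappa>0 x j" and \<kappa>: "\<kappa> = \<kappa>0 @ a # \<kappa>1" and a: "is_call (snd a)"
    and st: "step f P x a x'"
  shows "sim (\<kappa>0 @ [a]) x' j"
proof -
  let ?n = "length (history \<kappa>0)"
  let ?D = "\<lambda>n. ({..<n} - emitted j) \<union> (emitted j - {..<n})"
  note nth = H_nth_length[OF \<kappa> disjI1[OF a]]
  have len: "length (history (\<kappa>0 @ [a])) = Suc ?n" using a by simp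
  from sim obtain \<kappa>' y z L where
    j: "j \<le> length H'" and
    rets: "\<forall>k<?n. is_ret (snd (H ! k)) \<longrightarrow> k \<in> emitted j"
    and calls: "\<forall>k\<in>emitted j. is_call (snd (H ! k)) \<longrightarrow> k < ?n"
    and hist: "history \<kappa>' = take j H'"
    and ex: "filter (\<lambda>a. \<not> is_interface (snd a)) \<kappa>' = filter (\<lambda>a. \<not> is_interface (snd a)) \<kappa>0"
    and mk: "\<forall>t. marks 0 (proj t \<kappa>') = marks 0 (proj t \<kappa>0)"
    and ru: "(y, \<kappa>') \<in> runs f P \<kappa>' s0" and xz: "x \<odot> z = Some y"
    and big: "sep_big pay (?D ?n) z"
    and fpL: "fp_eval (take j H') (fp L0) = Some (fp L)" and yL: "y \<odot> L \<noteq> None"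
    unfolding sim_def by blast
  have n: "?n \<notin> emitted j" using calls nth a by blast
  have D: "?D (Suc ?n) = insert ?n (?D ?n)" "?n \<notin> ?D ?n"
    using n unfolding lessThan_Suc by auto
  have "pay ?n \<odot> x' = Some x" using st step_call[OF a] H_annotated[OF nth(1)] nth(2) by metis
  then have "x' \<odot> pay ?n = Some x" by (simp add: sep_comm)
  then obtain z' where z': "pay ?n \<odot> z = Some z'" "x' \<odot> z' = Some y"
    using sep_assoc_right xz by blast
  have "sep_big pay (?D (Suc ?n)) z'"
    unfolding D(1) by (rule sep_big_insert[OF big D(2) z'(1)])
  moreover have "filter (\<lambda>a. \<not> is_interface (snd a)) \<kappa>' = filter (\<lambda>a. \<not> is_interface (snd a)) (\<kappa>0 @ [a])"
    using ex a by simp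
  moreover have "\<forall>t. marks 0 (proj t \<kappa>') = marks 0 (proj t (\<kappa>0 @ [a]))"
    using mk marks_proj_snoc_interface[OF disjI1[OF a]] by metis
  moreover have "\<forall>k<Suc ?n. is_ret (snd (H ! k)) \<longrightarrow> k \<in> emitted j"
  proof -
    have "\<not> is_ret (snd (H ! ?n))" using a nth(2) by (cases "snd a") auto
    then show ?thesis using rets less_Suc_eq by metis
  qed
  moreover have "\<forall>k\<in>emitted j. is_call (snd (H ! k)) \<longrightarrow> k < Suc ?n" using calls less_SucI by blast
  ultimately show ?thesis
    unfolding sim_def len using j hist ru fpL yL z'(2) by blast
qed

lemma sim_ret:
  assumes sim: "sim \<kappa>0 x j" and \<kappa>: "\<kappa> = \<kappa>0 @ a # \<kappa>1" and a: "is_ret (snd a)"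
    and st: "step f P x a x'"
  shows "\<exists>j. sim (\<kappa>0 @ [a]) x' j"
proof -
  let ?n = "length (history \<kappa>0)"
  note nth = H_nth_length[OF \<kappa> disjI2[OF a]]
  have len: "length (history (\<kappa>0 @ [a])) = Suc ?n" using a by simp
  \<comment> \<open>\<open>Suc\<close> includes the return itself, and \<open>max\<close> covers the
    case that it was emitted earlier.\<close>
  define j' where "j' = max j (Suc (\<rho> ?n))"
  let ?D = "\<lambda>n. ({..<n} - emitted j') \<union> (emitted j' - {..<n})"
  have ncall: "\<not> is_call (snd (H ! ?n))" using a nth(2) by (cases "snd a") auto
  have "sim \<kappa>0 x j'"
  proof (rule sim_emit_upto[OF sim])
    show "j \<le> j'" by (simp add: j'_def)
    show "j' \<le> length H'" using sim \<rho>_less[OF nth(1)] by (simp add: j'_def sim_def)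
    fix k assume k: "k < length H" "j \<le> \<rho> k" "\<rho> k < j'" "is_call (snd (H ! k))"
    then have "\<rho> k \<le> \<rho> ?n" by (auto simp: j'_def)
    \<comment> \<open>A call after this return in \<open>H\<close> would also come after it in
      \<open>H'\<close>; thus every call to be emitted here has been reached.\<close>
    then have "\<not> ?n < k" using mono[of ?n k] k a nth(2) by auto
    moreover have "k \<noteq> ?n" using k(4) ncall by blast
    ultimately show "k < ?n" by simp
  qed
  then obtain \<kappa>' y z L where
    j: "j' \<le> length H'" and
    rets: "\<forall>k<?n. is_ret (snd (H ! k)) \<longrightarrow> k \<in> emitted j'"
    and calls: "\<forall>k\<in>emitted j'. is_call (snd (H ! k)) \<longrightarrow> k < ?n"
    and hist: "history \<kappa>' = take j' H'"
    and ex: "filter (\<lambda>a. \<not> is_interface (snd a)) \<kappa>' = filter (\<lambda>a. \<not> is_interface (snd a)) \<kappa>0"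
    and mk: "\<forall>t. marks 0 (proj t \<kappa>') = marks 0 (proj t \<kappa>0)"
    and ru: "(y, \<kappa>') \<in> runs f P \<kappa>' s0" and xz: "x \<odot> z = Some y"
    and big: "sep_big pay (?D ?n) z"
    and fpL: "fp_eval (take j' H') (fp L0) = Some (fp L)" and yL: "y \<odot> L \<noteq> None"
    unfolding sim_def by blast
  have n: "?n \<in> emitted j'" using nth(1) by (simp add: j'_def)
  \<comment> \<open>With respect to \<open>\<kappa>0\<close> the return counts as early; once
    \<open>\<kappa>0\<close> performs it, the difference disappears.\<close>
  have D: "?D (Suc ?n) = ?D ?n - {?n}" "?n \<in> ?D ?n"
    using n unfolding lessThan_Suc by auto
  obtain z' where z': "sep_big pay (?D (Suc ?n)) z'" "pay ?n \<odot> z' = Some z"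
    unfolding D(1) using sep_big_remove[OF big D(2)] by blast
  have "x \<odot> pay ?n = Some x'" using st step_ret[OF a] H_annotated[OF nth(1)] nth(2) by metis
  moreover obtain u where "x \<odot> pay ?n = Some u" "u \<odot> z' = Some y"
    using sep_assoc_left z'(2) xz by blast
  ultimately have "x' \<odot> z' = Some y" by simp
  moreover have "filter (\<lambda>a. \<not> is_interface (snd a)) \<kappa>' = filter (\<lambda>a. \<not> is_interface (snd a)) (\<kappa>0 @ [a])"
    using ex a by simp
  moreover have "\<forall>t. marks 0 (proj t \<kappa>') = marks 0 (proj t (\<kappa>0 @ [a]))"
    using mk marks_proj_snoc_interface[OF disjI2[OF a]] by metis
  moreover have "\<forall>k<Suc ?n. is_ret (snd (H ! k)) \<longrightarrow> k \<in> emitted j'"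
    using rets n less_Suc_eq by metis
  moreover have "\<forall>k\<in>emitted j'. is_call (snd (H ! k)) \<longrightarrow> k < Suc ?n" using calls less_SucI by blast
  ultimately have "sim (\<kappa>0 @ [a]) x' j'"
    unfolding sim_def len using j hist ru fpL yL z'(1) by blast
  then show ?thesis ..
qed

text \<open>When thread \<open>t\<close> is not inside a method, it has performed the same interface actions on both
  sides: the only differences could be calls not yet emitted or returns emitted early, but the
  former are followed, and the latter preceded, by an action of \<open>t\<close> that rules them out.\<close>

lemma idle_same_actions:
  assumes \<kappa>: "\<kappa> = \<kappa>0 @ \<kappa>1" and idle: "\<not> busy (\<lambda>_. False) \<kappa>0 t"
    and rets: "\<forall>k<length (history \<kappa>0). is_ret (snd (H ! k)) \<longrightarrow> k \<in> emitted j"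
    and calls: "\<forall>k\<in>emitted j. is_call (snd (H ! k)) \<longrightarrow> k < length (history \<kappa>0)"
  shows "{k \<in> emitted j. fst (H ! k) = t} = {k. k < length (history \<kappa>0) \<and> fst (H ! k) = t}"
proof -
  let ?n = "length (history \<kappa>0)"
  have n: "?n \<le> length H" using \<kappa> by (simp add: H_def)
  have Hn: "H ! k = history \<kappa>0 ! k" if "k < ?n" for k using \<kappa> that by (simp add: H_def nth_append)
  have ret: "\<exists>k'\<ge>k. k' < ?n \<and> fst (H ! k') = t \<and> is_ret (snd (H ! k'))"
    if "k < ?n" "fst (H ! k) = t" for k
    using idle_ret[OF idle, of k] that Hn by metis
  have "k \<in> emitted j" if k: "k < ?n" "fst (H ! k) = t" for k
  proof -
    obtain k' where k': "k' \<ge> k" "k' < ?n" "fst (H ! k') = t" "is_ret (snd (H ! k'))"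
      using ret k by blast
    then have "k' \<in> emitted j" using rets by blast
    moreover have "\<rho> k \<le> \<rho> k'"
      using mono[of k k'] k k' n by (cases "k = k'") auto
    ultimately show ?thesis using k n by auto
  qed
  moreover have "k < ?n" if k: "k \<in> emitted j" "fst (H ! k) = t" for k
  proof (rule ccontr)
    assume nk: "\<not> k < ?n"
    then have "is_ret (snd (H ! k))" using k calls H_interface by blast
    moreover have "is_trace H" using trace unfolding is_trace_def H_def history_def by simp
    moreover have "history H = H" by (simp add: H_def history_def)
    ultimately obtain k' where k': "k' < k" "fst (H ! k') = t" "is_call (snd (H ! k'))"
      \<comment> \<open>The call \<open>k'\<close> of the early return \<open>k\<close> has been
        reached, so idleness yields a return of \<open>t\<close> strictly between the two,
        contradicting their adjacency.\<close>
      "\<forall>i. k' < i \<and> i < k \<longrightarrow> fst (H ! i) \<noteq> t"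
      using trace_ret_call[of H k] k by auto
    have "\<rho> k' < \<rho> k" using mono[of k' k] k' k by auto
    then have "k' \<in> emitted j" using k k' by auto
    then have "k' < ?n" using calls k'(3) by blast
    then obtain i where i: "i \<ge> k'" "i < ?n" "fst (H ! i) = t" "is_ret (snd (H ! i))"
      using ret k'(2) by blast
    have "i \<noteq> k'" using i(4) k'(3) by (cases "snd (H ! i)") auto
    then show False using i k'(4) nk by auto
  qed
  ultimately show ?thesis by blast
qed

text \<open>\<open>\<rho>\<close> maps the emitted positions bijectively onto the first
  \<open>j\<close> positions of \<open>H'\<close> and preserves the actions there.\<close>

lemma card_emitted:
  assumes "j \<le> length H'"
  shows "card {k \<in> emitted j. Q (H ! k)} = length (filter Q (take j H'))"
proof -
  have "bij_betw \<rho> {k \<in> emitted j. Q (H ! k)} {i. i < length (take j H') \<and> Q (take j H' ! i)}"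
  proof (rule bij_betw_imageI)
    show "inj_on \<rho> {k \<in> emitted j. Q (H ! k)}" using \<rho>_eq_iff by (auto simp: inj_on_def)
    show "\<rho> ` {k \<in> emitted j. Q (H ! k)} = {i. i < length (take j H') \<and> Q (take j H' ! i)}"
    proof
      show "\<rho> ` {k \<in> emitted j. Q (H ! k)} \<subseteq> {i. i < length (take j H') \<and> Q (take j H' ! i)}"
        using H'_nth \<rho>_less by auto
      show "{i. i < length (take j H') \<and> Q (take j H' ! i)} \<subseteq> \<rho> ` {k \<in> emitted j. Q (H ! k)}"
      proof
        fix i assume i: "i \<in> {i. i < length (take j H') \<and> Q (take j H' ! i)}"
        then obtain k where "k < length H" "\<rho> k = i" using \<rho>_surj[of i] by auto
        then show "i \<in> \<rho> ` {k \<in> emitted j. Q (H ! k)}" using i H'_nth by auto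
      qed
    qed
  qed
  then show ?thesis by (simp add: bij_betw_same_card length_filter_conv_card)
qed

text \<open>The command acts on \<open>x\<close> with \<open>z\<close> as frame. Footprint
  preservation keeps \<open>x'\<close> compatible with \<open>z\<close>, and the new
  \<open>y'\<close> compatible with \<open>L\<close>.\<close>

lemma sim_exec:
  assumes sim: "sim \<kappa>0 x j" and \<kappa>: "\<kappa> = \<kappa>0 @ a # \<kappa>1" and a: "is_exec (snd a)"
    and st: "step f P x a x'"
  shows "sim (\<kappa>0 @ [a]) x' j"
proof -
  let ?n = "length (history \<kappa>0)"
  let ?D = "({..<?n} - emitted j) \<union> (emitted j - {..<?n})"
  have nint: "\<not> is_interface (snd a)" using a not_interface_iff_exec by blast
  obtain t c where tc: "a = (t, Exec c)" using a by (cases a; cases "snd a") auto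
  from sim obtain \<kappa>' y z L where
    j: "j \<le> length H'" and
    rets: "\<forall>k<?n. is_ret (snd (H ! k)) \<longrightarrow> k \<in> emitted j"
    and calls: "\<forall>k\<in>emitted j. is_call (snd (H ! k)) \<longrightarrow> k < ?n"
    and hist: "history \<kappa>' = take j H'"
    and ex: "filter (\<lambda>a. \<not> is_interface (snd a)) \<kappa>' = filter (\<lambda>a. \<not> is_interface (snd a)) \<kappa>0"
    and mk: "\<forall>t. marks 0 (proj t \<kappa>') = marks 0 (proj t \<kappa>0)"
    and ru: "(y, \<kappa>') \<in> runs f P \<kappa>' s0" and xz: "x \<odot> z = Some y"
    and big: "sep_big pay ?D z"
    and fpL: "fp_eval (take j H') (fp L0) = Some (fp L)" and yL: "y \<odot> L \<noteq> None"
    unfolding sim_def by blast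
  obtain S where S: "f t c x = Some S" "x' \<in> S" using st tc step_exec by metis
  have fy: "f t c y = Some (sep_prod S {z})" using loc xz S(1) unfolding strongly_local_def by blast
  have "fp x' = fp x" using fpp S unfolding footprint_preserving_def by blast
  then obtain y' where y': "x' \<odot> z = Some y'" using xz fp_eq_defined by blast
  then have Sy: "y' \<in> sep_prod S {z}" using S(2) by (auto simp: sep_prod_def)
  then have "step f P y a y'" using fy tc step_exec by metis
  then have run': "(y', \<kappa>' @ [a]) \<in> runs f P (\<kappa>' @ [a]) s0" using ru runs_self_snoc by blast
  have "fp y' = fp y" using fpp fy Sy unfolding footprint_preserving_def by blast
  then have yL': "y' \<odot> L \<noteq> None" using yL fp_eq_defined by blast
  \<comment> \<open>Since \<open>t\<close> is idle, it has performed equally many interface actions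
    in both traces, so the command receives the same mark in each.\<close>
  have "\<not> busy (\<lambda>_. False) \<kappa>0 t" using idle[of \<kappa>0 t "Exec c" \<kappa>1] \<kappa> tc by simp
  then have "{k \<in> emitted j. fst (H ! k) = t} = {k. k < ?n \<and> fst (H ! k) = t}"
    using idle_same_actions[OF \<kappa> _ rets calls] by blast
  then have "length (filter (\<lambda>b. fst b = t) (take j H')) = card {k. k < ?n \<and> fst (H ! k) = t}"
    using card_emitted[OF j, of "\<lambda>b. fst b = t"] by simp
  also have "{k. k < ?n \<and> fst (H ! k) = t} = {k. k < ?n \<and> fst (history \<kappa>0 ! k) = t}"
    using \<kappa> by (auto simp: H_def nth_append)
  finally have "length (history (proj t \<kappa>')) = length (history (proj t \<kappa>0))"
    unfolding proj_history[symmetric] hist unfolding proj_def by (simp add: length_filter_conv_card)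
  then have "\<forall>u. marks 0 (proj u (\<kappa>' @ [a])) = marks 0 (proj u (\<kappa>0 @ [a]))"
    using mk tc by (auto simp: marks_append)
  moreover have "filter (\<lambda>a. \<not> is_interface (snd a)) (\<kappa>' @ [a]) = filter (\<lambda>a. \<not> is_interface (snd a)) (\<kappa>0 @ [a])"
    using ex by simp
  moreover have "history (\<kappa>' @ [a]) = take j H'" using nint hist by simp
  moreover have len: "length (history (\<kappa>0 @ [a])) = ?n" using nint by simp
  ultimately show ?thesis unfolding sim_def len
    using j rets calls run' y' big fpL yL' by blast
qed

lemma sim_prefix:
  "\<kappa> = \<kappa>0 @ \<kappa>1 \<Longrightarrow> (x, \<kappa>0) \<in> runs f P \<kappa>0 s0 \<Longrightarrow> \<exists>j. sim \<kappa>0 x j"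
proof (induction \<kappa>0 arbitrary: \<kappa>1 x rule: rev_induct)
  case Nil
  then show ?case using sim_init by auto
next
  case (snoc a \<kappa>0)
  obtain u where u: "(u, \<kappa>0) \<in> runs f P \<kappa>0 s0" "step f P u a x"
    using snoc.prems(2) runs_self_snoc by blast
  have \<kappa>: "\<kappa> = \<kappa>0 @ a # \<kappa>1" using snoc.prems(1) by simp
  obtain j where "sim \<kappa>0 u j" using snoc.IH[OF \<kappa> u(1)] by blast
  then show ?case using sim_call[OF _ \<kappa> _ u(2)] sim_ret[OF _ \<kappa> _ u(2)] sim_exec[OF _ \<kappa> _ u(2)]
    not_interface_iff_exec[of "snd a"] by blast
qed

text \<open>Once all of \<open>H'\<close> is emitted, marks and histories agree for every thread,
  and together they determine the projections.\<close>

lemma rearranged: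
  "\<exists>\<kappa>' y. history \<kappa>' = H' \<and> (y, \<kappa>') \<in> runs f P \<kappa>' s0 \<and> (\<forall>t. proj t \<kappa>' = proj t \<kappa>) \<and>
     filter (\<lambda>a. \<not> is_interface (snd a)) \<kappa>' = filter (\<lambda>a. \<not> is_interface (snd a)) \<kappa>"
proof -
  obtain j where sim: "sim \<kappa> s1 j" using sim_prefix[of \<kappa> "[]"] run by auto
  have "j \<le> length H'" using sim by (simp add: sim_def)
  \<comment> \<open>With \<open>\<kappa>\<close> fully replayed, all returns are emitted, and the
    calls that remain in \<open>H'\<close> have all been reached.\<close>
  then have "sim \<kappa> s1 (length H')"
    by (rule sim_emit_upto[OF sim]) (simp_all flip: H_def)
  then obtain \<kappa>' y where *: "history \<kappa>' = H'" "(y, \<kappa>') \<in> runs f P \<kappa>' s0"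
    "\<forall>t. marks 0 (proj t \<kappa>') = marks 0 (proj t \<kappa>)"
    "filter (\<lambda>a. \<not> is_interface (snd a)) \<kappa>' = filter (\<lambda>a. \<not> is_interface (snd a)) \<kappa>"
    unfolding sim_def by auto
  have "proj t H = proj t H'" for t using history_le_proj[OF bij H'_nth] mono by blast
  then have "history (proj t \<kappa>') = history (proj t \<kappa>)" for t
    using *(1) by (simp add: H_def flip: proj_history)
  then have "proj t \<kappa>' = proj t \<kappa>" for t using marks_history_inj *(3) by blast
  then show ?thesis using * by blast
qed

end

section \<open>Abstraction\<close>

theorem theorem6p4:
  fixes f :: "('c, 's::footprint_sep_algebra) transformers"
    and \<Gamma> :: "('m, 's) method_spec"
    and L1 :: "('c, 'm) library"
    and Cs :: "('c, 'm) client"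
    and I1 I :: "'s set"
    and \<H>2 :: "('s set \<times> ('c, 'm, 's) trace) set"
  assumes "footprint_preserving f"
    and "strongly_local f"
    and "is_method_spec \<Gamma>"
    and "is_library L1"
    and "interface_set \<H>2"
    and "safe f (LibLocal L1 \<Gamma>) I1"
    and "safe f (ClientLocal \<Gamma> Cs) I"
    and "interface_le (interf f L1 \<Gamma> I1) \<H>2"
  shows "safe f (Complete Cs L1) (sep_prod I I1) \<and>
    (\<forall>(\<sigma>, \<tau>1) \<in> sem_on f (Complete Cs L1) (sep_prod I I1).
      \<exists>\<sigma>' \<kappa> l. (\<sigma>', \<kappa>) \<in> sem_on f (ClientLocal \<Gamma> Cs) I \<and>
        (l, history \<kappa>) \<in> \<H>2 \<and>
        fp_comp (fp \<sigma>') l \<noteq> None \<and>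
        client \<tau>1 \<sim> ground \<kappa>)"
proof -
  let ?P = "Complete Cs L1 :: ('c, 'm, 's) program" and ?C = "ClientLocal \<Gamma> Cs" and ?L = "LibLocal L1 \<Gamma>"
  note dec = decomposition[OF assms(2,4,6,7)]
  have safe: "safe f ?P (sep_prod I I1)"
  proof (rule safeI)
    fix s \<tau> assume "s \<in> sep_prod I I1" "\<tau> \<in> traces ?P"
    then show "eval_trace f ?P \<tau> s \<noteq> None" unfolding sep_prod_def using dec by blast
  qed
  have "\<exists>\<sigma>' \<kappa> l. (\<sigma>', \<kappa>) \<in> sem_on f ?C I \<and> (l, history \<kappa>) \<in> \<H>2 \<and>
      fp_comp (fp \<sigma>') l \<noteq> None \<and> client \<tau>1 \<sim> ground \<kappa>"
    if run1: "(\<sigma>, \<tau>1) \<in> sem_on f ?P (sep_prod I I1)" for \<sigma> \<tau>1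
  proof -
    let ?c = "part False (\<lambda>_. False)" and ?l = "part True (\<lambda>_. False)"
    obtain \<tau> s where \<tau>: "\<tau> \<in> traces ?P" "(s, \<tau>1) \<in> runs f ?P \<tau> \<sigma>" and "\<sigma> \<in> sep_prod I I1"
      using run1 unfolding sem_on_safe[OF safe] by blast
    then obtain \<sigma>c \<sigma>l where \<sigma>: "\<sigma>c \<in> I" "\<sigma>l \<in> I1" "\<sigma>c \<odot> \<sigma>l = Some \<sigma>"
      unfolding sep_prod_def by blast
    obtain sc sl \<kappa> \<xi> where \<kappa>: "(sc, \<kappa>) \<in> runs f ?C (?c \<tau>) \<sigma>c"
      and \<xi>: "(sl, \<xi>) \<in> runs f ?L (?l \<tau>) \<sigma>l" and h: "history \<kappa> = history \<xi>"
      using dec[OF \<sigma> \<tau>(1)] \<tau>(2) by blast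
    have c\<tau>: "?c \<tau> \<in> traces ?C" using part_False_traces[OF assms(4) \<tau>(1)] .
    have ground\<tau>: "ground \<tau> = \<tau>" using traces_Complete_ground[OF assms(4) \<tau>(1)] .
    have ground_c: "ground (?c \<tau>) = ?c \<tau>"
      using ground\<tau> set_part[of False "\<lambda>_. False" \<tau>] unfolding ground_eq_iff by blast
    have ground\<kappa>: "ground \<kappa> = ?c \<tau>" using runs_ground_eq[OF \<kappa>] ground_c by simp
    have "\<tau>1 = \<tau>" using runs_Complete[OF \<tau>(2)] ground\<tau> by simp
    then have client: "client \<tau>1 = ground \<kappa>" using ground\<kappa> client_eq_part by metis
    \<comment> \<open>The evaluated trace is exchanged for its annotated result, which fixes the
      transferred states for the replay.\<close>
    have run: "(sc, \<kappa>) \<in> runs f ?C \<kappa> \<sigma>c" using \<kappa> runs_ground[of f ?C \<kappa>] ground\<kappa> by metis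
    have "(fp \<sigma>l, history \<kappa>) \<in> interf f L1 \<Gamma> I1"
      unfolding interf_def h using sem_on_safe[OF assms(6)] \<sigma>(2) \<xi> part_True_traces[OF assms(4) \<tau>(1)]
      by blast
    then obtain l' H' where H': "(l', H') \<in> \<H>2" "fp_le l' (fp \<sigma>l)" "history_le (history \<kappa>) H'"
      using assms(8) unfolding interface_le_def by blast
    obtain L0 b x where L0: "l' = fp L0" "fp \<sigma>l = fp x" "L0 \<odot> b = Some x"
      using fp_minusE H'(2) unfolding fp_le_def by metis
    \<comment> \<open>\<open>\<sigma>c\<close> is compatible with \<open>\<sigma>l\<close>, hence
      with \<open>x\<close> of the same footprint, and hence with the part \<open>L0\<close> of
      \<open>x\<close>.\<close>
    have "\<sigma>c \<odot> x \<noteq> None" using fp_eq_defined_right[OF L0(2), of \<sigma>c] \<sigma>(3) by simp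
    then obtain u where u: "\<sigma>c \<odot> L0 = Some u" using sep_assoc_left[OF L0(3)] by blast
    have hist: "is_history H'" "balanced (fp L0) H'"
      using assms(5) H'(1) L0(1) unfolding interface_set_def by auto
    from H'(3) obtain \<rho> where \<rho>: "bij_betw \<rho> {..<length (history \<kappa>)} {..<length H'}"
      "\<And>i. i < length (history \<kappa>) \<Longrightarrow> history \<kappa> ! i = H' ! \<rho> i"
      "\<And>i j. i < j \<Longrightarrow> j < length (history \<kappa>) \<Longrightarrow>
        fst (history \<kappa> ! i) = fst (history \<kappa> ! j) \<or>
        is_ret (snd (history \<kappa> ! i)) \<and> is_call (snd (history \<kappa> ! j)) \<Longrightarrow> \<rho> i < \<rho> j"
      unfolding history_le_def by blast
    interpret rearrangement f \<Gamma> Cs \<kappa> "history \<kappa>" H' \<rho> \<sigma>c sc L0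
    proof
      \<comment> \<open>Every action of \<open>history \<kappa>\<close> reappears in
        \<open>H'\<close>, whose actions are annotated because \<open>\<H>2\<close> is an interface
        set.\<close>
      show "annotated (snd a)" if mem: "a \<in> set (history \<kappa>)" for a
      proof -
        obtain i where i: "i < length (history \<kappa>)" "a = history \<kappa> ! i"
          using mem by (metis in_set_conv_nth)
        have "\<rho> i < length H'" using bij_betw_apply[OF \<rho>(1)] i(1) by blast
        then have "a \<in> set H'" using \<rho>(2) i by simp
        then show ?thesis using hist(1) by (simp add: is_history_def)
      qed
      show "is_trace \<kappa>" using traces_ClientLocal_is_trace[OF c\<tau>] ground\<kappa> is_trace_ground by metis
      show "\<not> busy (\<lambda>_. False) \<kappa>0 t" if "\<kappa> = \<kappa>0 @ (t, a) # \<kappa>1" "is_exec a" for \<kappa>0 t a \<kappa>1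
      proof -
        have "?c \<tau> = ground \<kappa>0 @ (t, erase a) # ground \<kappa>1" using ground\<kappa> that(1) by simp
        then have "\<not> busy (\<lambda>_. False) (ground \<kappa>0) t"
          by (rule part_False_exec) (simp add: that(2))
        then show ?thesis by simp
      qed
    qed (fact assms(1,2) run \<rho> hist(2) refl | simp add: u)+
    obtain \<kappa>' y where \<kappa>': "history \<kappa>' = H'" "(y, \<kappa>') \<in> runs f ?C \<kappa>' \<sigma>c" "\<And>t. proj t \<kappa>' = proj t \<kappa>"
      "filter (\<lambda>a. \<not> is_interface (snd a)) \<kappa>' = filter (\<lambda>a. \<not> is_interface (snd a)) \<kappa>"
      using rearranged by blast
    have pg: "proj t (ground \<kappa>') = proj t (ground \<kappa>)" for t using \<kappa>'(3) by (simp add: proj_ground)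
    then have "ground \<kappa>' \<in> traces ?C" using traces_ClientLocal_proj c\<tau> ground\<kappa> by metis
    moreover have "(y, \<kappa>') \<in> runs f ?C (ground \<kappa>') \<sigma>c" using \<kappa>'(2) by (simp add: runs_ground)
    \<comment> \<open>The rearranged run still starts from \<open>\<sigma>c\<close>, which serves as
      the witness for the client state, with \<open>l'\<close> as the library footprint.\<close>
    ultimately have "(\<sigma>c, \<kappa>') \<in> sem_on f ?C I" unfolding sem_on_safe[OF assms(7)] using \<sigma>(1) by blast
    moreover have "client \<tau>1 \<sim> ground \<kappa>'"
      unfolding client_equiv_def client filter_not_interface_ground using pg \<kappa>'(4) by simp
    moreover have "(l', history \<kappa>') \<in> \<H>2" using H'(1) \<kappa>'(1) by simp
    moreover have "fp_comp (fp \<sigma>c) l' \<noteq> None" using fp_comp_fp[OF u] L0(1) by simp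
    ultimately show ?thesis by blast
  qed
  then show ?thesis using safe by blast
qed

end
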